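(* Let $(M,\phi,\xi,\eta,g)$ be a $(2n+1)$-dimensional Kenmotsu manifold with a generalized symmetric metric connection $\bar\nabla$ of type $(\alpha,\beta)$, with Ricci tensor $\bar S$ and $W_2$-curvature tensor $\bar W_2$. If $(g,\xi,\lambda,\mu)$ is an $\eta$-Ricci soliton on $M$ (with respect to $\bar\nabla$) and $\bar S\cdot\bar W_2(\xi,X)=0$, then $$-(\alpha+1)(2\lambda+\alpha+1+\mu)+\frac{(\lambda+\alpha+1)^2+(\lambda+\mu)^2}{2n}=0$$ and $$\beta(\alpha+1)(2\lambda+\alpha+1+\mu)=0.$$
   Context: An almost contact metric manifold is a smooth manifold $M$ of odd dimension with a $(1,1)$-tensor field $\phi$, a vector field $\xi$, a 1-form $\eta$ and a Riemannian metric $g$ such that $\phi\xi=0$, $\eta(\phi X)=0$, $\eta(\xi)=1$, $\phi^2X=-X+\eta(X)\xi$, $g(\phi X,\phi Y)=g(X,Y)-\eta(X)\eta(Y)$, $g(X,\xi)=\eta(X)$. It is a Kenmotsu manifold if, with $\nabla$ the Levi-Civita connection, $(\nabla_X\phi)Y=g(\phi X,Y)\xi-\eta(Y)\phi X$ and $\nabla_X\xi=X-\eta(X)\xi$. For smooth functions $\alpha,\beta$ on $M$, the generalized symmetric metric connection of type $(\alpha,\beta)$ is the linear connection $\bar\nabla$ with $\bar\nabla g=0$ and torsion $T(X,Y)=\alpha\{\eta(Y)X-\eta(X)Y\}+\beta\{\eta(Y)\phi X-\eta(X)\phi Y\}$; explicitly $\bar\nabla_XY=\nabla_XY+\alpha\{\eta(Y)X-g(X,Y)\xi\}-\beta\eta(X)\phi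 Y$. Its curvature tensor is $\bar R(X,Y)Z=\bar\nabla_X\bar\nabla_YZ-\bar\nabla_Y\bar\nabla_XZ-\bar\nabla_{[X,Y]}Z$, its Ricci tensor is $\bar S(Y,Z)=\operatorname{trace}(X\mapsto\bar R(X,Y)Z)$, and its Ricci operator $\bar Q$ is defined by $g(\bar QX,Y)=\bar S(X,Y)$. The $W_2$-curvature tensor of $\bar\nabla$ is $\bar W_2(X,Y)Z=\bar R(X,Y)Z+\frac{1}{\dim M-1}\bigl[g(X,Z)\bar QY-g(Y,Z)\bar QX\bigr]$. For real constants $\lambda,\mu$, the data $(g,\xi,\lambda,\mu)$ is an $\eta$-Ricci soliton on $M$ if $\mathcal L_\xi g+2\bar S+2\lambda g+2\mu\,\eta\otimes\eta=0$, where $\mathcal L_\xi g$ is written in terms of $\bar\nabla$, i.e. $2\bar S(X,Y)=-g(\bar\nabla_X\xi,Y)-g(X,\bar\nabla_Y\xi)-2\lambda g(X,Y)-2\mu\eta(X)\eta(Y)$ for all vector fields $X,Y$. The condition $\bar S\cdot\bar W_2(\xi,X)=0$ means that for all vector fields $X,Y,Z,V$ on $M$ $$\bar S(X,\bar W_2(Y,Z)V)\xi-\bar S(\xi,\bar W_2(Y,Z)V)X+\bar S(X,Y)\bar W_2(\xi,Z)V-\bar S(\xi,Y)\bar W_2(X,Z)V$$ $$+\bar S(X,Z)\bar W_2(Y,\xi)V-\bar S(\xi,Z)\bar W_2(Y,X)V+\bar S(X,V)\bar W_2(Y,Z)\xi-\bar S(\xi,V)\bar W_2(Y,Z)X=0.$$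 *)

theory Defs
  imports "HOL-Analysis.Analysis" "HOL-Library.Function_Algebras"
begin

section \<open>Real-valued linear algebra on function spaces\<close>

instantiation "fun" :: (type, real_vector) real_vector
begin

definition scaleR_fun :: "real \<Rightarrow> ('a \<Rightarrow> 'b) \<Rightarrow> 'a \<Rightarrow> 'b"
  where "scaleR_fun c f = (\<lambda>x. c *\<^sub>R f x)"

instance
  by standard (simp_all add: scaleR_fun_def fun_eq_iff scaleR_add_right scaleR_add_left)

end

lemma scaleR_fun_apply [simp]: "(c *\<^sub>R f) x = c *\<^sub>R f x"
  by (simp add: scaleR_fun_def)

definition linear_on_subspace :: "'v::real_vector set \<Rightarrow> ('v \<Rightarrow> 'w::real_vector) \<Rightarrow> bool"
  where "linear_on_subspace V L \<longleftrightarrow>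
    (\<forall>u\<in>V. \<forall>v\<in>V. L (u + v) = L u + L v) \<and> (\<forall>c. \<forall>v\<in>V. L (c *\<^sub>R v) = c *\<^sub>R L v)"

text \<open>Trace of an endomorphism \<open>L\<close> of a finite-dimensional subspace \<open>V\<close>: the sum of the
  diagonal entries of its matrix with respect to some basis of \<open>V\<close>.\<close>

definition trace_on :: "'v::real_vector set \<Rightarrow> ('v \<Rightarrow> 'v) \<Rightarrow> real"
  where "trace_on V L =
    (let B = (SOME B. independent B \<and> span B = V) in \<Sum>b\<in>B. representation B (L b) b)"


section \<open>Smooth manifolds\<close>

text \<open>\<open>C_diff k U f\<close>: \<open>f\<close> is of class \<open>C\<^sup>k\<close> on the open set \<open>U\<close>.\<close>

fun C_diff :: "nat \<Rightarrow> 'e::euclidean_space set \<Rightarrow> ('e \<Rightarrow> 'f::real_normed_vector) \<Rightarrow> bool"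
  where
    "C_diff 0 U f \<longleftrightarrow> continuous_on U f"
  | "C_diff (Suc k) U f \<longleftrightarrow> (\<forall>x\<in>U. f differentiable (at x)) \<and>
       (\<forall>v. C_diff k U (\<lambda>x. frechet_derivative f (at x) v))"

definition smooth_on :: "'e::euclidean_space set \<Rightarrow> ('e \<Rightarrow> 'f::real_normed_vector) \<Rightarrow> bool"
  where "smooth_on U f \<longleftrightarrow> (\<forall>k. C_diff k U f)"

text \<open>The manifold is the whole (Hausdorff, second countable) space \<open>'a\<close>; a chart is a pair of
  its domain and its coordinate map into the model space \<open>'e\<close>, so \<open>DIM('e)\<close> is the dimension.
  The atlas need not be maximal.\<close>

type_synonym ('a, 'e) atlas = "('a set \<times> ('a \<Rightarrow> 'e)) set"

definition smooth_atlas ::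
    "('a::{t2_space, second_countable_topology}, 'e::euclidean_space) atlas \<Rightarrow> bool"
  where "smooth_atlas A \<longleftrightarrow>
    (\<forall>(U, c)\<in>A. open U \<and> open (c ` U) \<and> inj_on c U \<and>
       homeomorphism U (c ` U) c (inv_into U c)) \<and>
    (\<Union>(U, c)\<in>A. U) = UNIV \<and>
    (\<forall>(U, c)\<in>A. \<forall>(V, d)\<in>A. smooth_on (c ` (U \<inter> V)) (d \<circ> inv_into U c))"

definition C_inf :: "('a::topological_space, 'e::euclidean_space) atlas \<Rightarrow> ('a \<Rightarrow> real) set"
  where "C_inf A = {f. \<forall>(U, c)\<in>A. smooth_on (c ` U) (f \<circ> inv_into U c)}"


subsection \<open>Tangent vectors and vector fields\<close>

text \<open>Tangent vectors at \<open>p\<close> are the point derivations of the algebra of smooth functions. They are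
  represented by functionals on all functions, made unique by the value \<open>0\<close> at non-smooth ones.\<close>

type_synonym 'a tvec = "('a \<Rightarrow> real) \<Rightarrow> real"
type_synonym 'a vfield = "'a \<Rightarrow> 'a tvec"

definition tangent_space ::
    "('a::topological_space, 'e::euclidean_space) atlas \<Rightarrow> 'a \<Rightarrow> 'a tvec set"
  where "tangent_space A p = {v.
    (\<forall>f\<in>C_inf A. \<forall>h\<in>C_inf A. v (\<lambda>x. f x + h x) = v f + v h) \<and>
    (\<forall>c. \<forall>f\<in>C_inf A. v (\<lambda>x. c * f x) = c * v f) \<and>
    (\<forall>f\<in>C_inf A. \<forall>h\<in>C_inf A. v (\<lambda>x. f x * h x) = f p * v h + h p * v f) \<and>
    (\<forall>f. f \<notin> C_inf A \<longrightarrow> v f = 0)}"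

definition vector_field ::
    "('a::topological_space, 'e::euclidean_space) atlas \<Rightarrow> 'a vfield \<Rightarrow> bool"
  where "vector_field A X \<longleftrightarrow>
    (\<forall>p. X p \<in> tangent_space A p) \<and> (\<forall>f\<in>C_inf A. (\<lambda>p. X p f) \<in> C_inf A)"

definition fscale :: "('a \<Rightarrow> real) \<Rightarrow> 'a vfield \<Rightarrow> 'a vfield"  (infixr "\<odot>" 75)
  where "f \<odot> X = (\<lambda>p. f p *\<^sub>R X p)"

definition lie_bracket :: "'a vfield \<Rightarrow> 'a vfield \<Rightarrow> 'a vfield"
  where "lie_bracket X Y = (\<lambda>p f. X p (\<lambda>q. Y q f) - Y p (\<lambda>q. X q f))"


subsection \<open>Tensor fields\<close>

text \<open>Tensor fields are given pointwise on tangent spaces. Below are their actions on vector fields.\<close>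

definition app_form :: "('a \<Rightarrow> 'a tvec \<Rightarrow> real) \<Rightarrow> 'a vfield \<Rightarrow> 'a \<Rightarrow> real"
  where "app_form \<eta> X = (\<lambda>p. \<eta> p (X p))"

definition app_endo :: "('a \<Rightarrow> 'a tvec \<Rightarrow> 'a tvec) \<Rightarrow> 'a vfield \<Rightarrow> 'a vfield"
  where "app_endo \<phi> X = (\<lambda>p. \<phi> p (X p))"

definition app_metric :: "('a \<Rightarrow> 'a tvec \<Rightarrow> 'a tvec \<Rightarrow> real) \<Rightarrow> 'a vfield \<Rightarrow> 'a vfield \<Rightarrow> 'a \<Rightarrow> real"
  where "app_metric g X Y = (\<lambda>p. g p (X p) (Y p))"

definition one_form ::
    "('a::topological_space, 'e::euclidean_space) atlas \<Rightarrow> ('a \<Rightarrow> 'a tvec \<Rightarrow> real) \<Rightarrow> bool"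
  where "one_form A \<eta> \<longleftrightarrow>
    (\<forall>p. linear_on_subspace (tangent_space A p) (\<eta> p)) \<and>
    (\<forall>X. vector_field A X \<longrightarrow> app_form \<eta> X \<in> C_inf A)"

definition endo_field ::
    "('a::topological_space, 'e::euclidean_space) atlas \<Rightarrow> ('a \<Rightarrow> 'a tvec \<Rightarrow> 'a tvec) \<Rightarrow> bool"
  where "endo_field A \<phi> \<longleftrightarrow>
    (\<forall>p. \<phi> p ` tangent_space A p \<subseteq> tangent_space A p \<and>
         linear_on_subspace (tangent_space A p) (\<phi> p)) \<and>
    (\<forall>X. vector_field A X \<longrightarrow> vector_field A (app_endo \<phi> X))"

definition riemannian_metric ::
    "('a::topological_space, 'e::euclidean_space) atlas \<Rightarrow>
     ('a \<Rightarrow> 'a tvec \<Rightarrow> 'a tvec \<Rightarrow> real) \<Rightarrow> bool"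
  where "riemannian_metric A g \<longleftrightarrow>
    (\<forall>p. \<forall>u\<in>tangent_space A p. linear_on_subspace (tangent_space A p) (g p u)) \<and>
    (\<forall>p. \<forall>u\<in>tangent_space A p. \<forall>v\<in>tangent_space A p. g p u v = g p v u) \<and>
    (\<forall>p. \<forall>u\<in>tangent_space A p. u \<noteq> 0 \<longrightarrow> g p u u > 0) \<and>
    (\<forall>X Y. vector_field A X \<longrightarrow> vector_field A Y \<longrightarrow> app_metric g X Y \<in> C_inf A)"


subsection \<open>Linear connections\<close>

type_synonym 'a conn = "'a vfield \<Rightarrow> 'a vfield \<Rightarrow> 'a vfield"

definition linear_connection ::
    "('a::topological_space, 'e::euclidean_space) atlas \<Rightarrow> 'a conn \<Rightarrow> bool"
  where "linear_connection A D \<longleftrightarrow>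
    (\<forall>X Y. vector_field A X \<longrightarrow> vector_field A Y \<longrightarrow> vector_field A (D X Y)) \<and>
    (\<forall>X Y Z. vector_field A X \<longrightarrow> vector_field A Y \<longrightarrow> vector_field A Z \<longrightarrow>
       D (X + Y) Z = D X Z + D Y Z \<and> D Z (X + Y) = D Z X + D Z Y) \<and>
    (\<forall>f X Y. f \<in> C_inf A \<longrightarrow> vector_field A X \<longrightarrow> vector_field A Y \<longrightarrow>
       D (f \<odot> X) Y = f \<odot> D X Y \<and>
       D X (f \<odot> Y) = (\<lambda>p. X p f) \<odot> Y + f \<odot> D X Y)"

definition torsion :: "'a conn \<Rightarrow> 'a vfield \<Rightarrow> 'a vfield \<Rightarrow> 'a vfield"
  where "torsion D X Y = D X Y - D Y X - lie_bracket X Y"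

definition parallel_metric ::
    "('a::topological_space, 'e::euclidean_space) atlas \<Rightarrow>
     ('a \<Rightarrow> 'a tvec \<Rightarrow> 'a tvec \<Rightarrow> real) \<Rightarrow> 'a conn \<Rightarrow> bool"
  where "parallel_metric A g D \<longleftrightarrow>
    (\<forall>X Y Z. vector_field A X \<longrightarrow> vector_field A Y \<longrightarrow> vector_field A Z \<longrightarrow>
       (\<forall>p. X p (app_metric g Y Z) - app_metric g (D X Y) Z p - app_metric g Y (D X Z) p = 0))"

definition levi_civita ::
    "('a::topological_space, 'e::euclidean_space) atlas \<Rightarrow>
     ('a \<Rightarrow> 'a tvec \<Rightarrow> 'a tvec \<Rightarrow> real) \<Rightarrow> 'a conn \<Rightarrow> bool"
  where "levi_civita A g D \<longleftrightarrow>
    linear_connection A D \<and> parallel_metric A g D \<and>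
    (\<forall>X Y. vector_field A X \<longrightarrow> vector_field A Y \<longrightarrow> torsion D X Y = 0)"

definition curvature :: "'a conn \<Rightarrow> 'a vfield \<Rightarrow> 'a vfield \<Rightarrow> 'a vfield \<Rightarrow> 'a vfield"
  where "curvature D X Y Z = D X (D Y Z) - D Y (D X Z) - D (lie_bracket X Y) Z"

text \<open>A tensorial (\<open>C\<^sup>\<infinity>\<close>-linear) operator \<open>F\<close> on vector fields induces the endomorphism
  \<open>induced_endo A F p\<close> of the tangent space at \<open>p\<close>, through any extension of a tangent vector
  to a vector field.\<close>

definition induced_endo ::
    "('a::topological_space, 'e::euclidean_space) atlas \<Rightarrow> ('a vfield \<Rightarrow> 'a vfield) \<Rightarrow>
     'a \<Rightarrow> 'a tvec \<Rightarrow> 'a tvec"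
  where "induced_endo A F p v = F (SOME X. vector_field A X \<and> X p = v) p"

definition ricci ::
    "('a::topological_space, 'e::euclidean_space) atlas \<Rightarrow> 'a conn \<Rightarrow>
     'a vfield \<Rightarrow> 'a vfield \<Rightarrow> 'a \<Rightarrow> real"
  where "ricci A D Y Z =
    (\<lambda>p. trace_on (tangent_space A p) (induced_endo A (\<lambda>X. curvature D X Y Z) p))"

definition ricci_operator ::
    "('a::topological_space, 'e::euclidean_space) atlas \<Rightarrow>
     ('a \<Rightarrow> 'a tvec \<Rightarrow> 'a tvec \<Rightarrow> real) \<Rightarrow> 'a conn \<Rightarrow> 'a vfield \<Rightarrow> 'a vfield"
  where "ricci_operator A g D X =
    (THE W. vector_field A W \<and> (\<forall>Y. vector_field A Y \<longrightarrow> app_metric g W Y = ricci A D X Y))"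

definition W2_curvature ::
    "('a::topological_space, 'e::euclidean_space) atlas \<Rightarrow>
     ('a \<Rightarrow> 'a tvec \<Rightarrow> 'a tvec \<Rightarrow> real) \<Rightarrow> 'a conn \<Rightarrow>
     'a vfield \<Rightarrow> 'a vfield \<Rightarrow> 'a vfield \<Rightarrow> 'a vfield"
  where "W2_curvature A g D X Y Z = curvature D X Y Z +
    (1 / (real DIM('e) - 1)) *\<^sub>R
      (app_metric g X Z \<odot> ricci_operator A g D Y - app_metric g Y Z \<odot> ricci_operator A g D X)"


section \<open>Kenmotsu manifolds\<close>

definition almost_contact_metric ::
    "('a::{t2_space, second_countable_topology}, 'e::euclidean_space) atlas \<Rightarrow>
     ('a \<Rightarrow> 'a tvec \<Rightarrow> 'a tvec) \<Rightarrow> 'a vfield \<Rightarrow> ('a \<Rightarrow> 'a tvec \<Rightarrow> real) \<Rightarrow>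
     ('a \<Rightarrow> 'a tvec \<Rightarrow> 'a tvec \<Rightarrow> real) \<Rightarrow> bool"
  where "almost_contact_metric A \<phi> \<xi> \<eta> g \<longleftrightarrow>
    smooth_atlas A \<and> odd DIM('e) \<and>
    endo_field A \<phi> \<and> vector_field A \<xi> \<and> one_form A \<eta> \<and> riemannian_metric A g \<and>
    (\<forall>p. \<phi> p (\<xi> p) = 0 \<and> \<eta> p (\<xi> p) = 1 \<and>
      (\<forall>u\<in>tangent_space A p.
         \<eta> p (\<phi> p u) = 0 \<and>
         \<phi> p (\<phi> p u) = - u + \<eta> p u *\<^sub>R \<xi> p \<and>
         g p u (\<xi> p) = \<eta> p u \<and>
         (\<forall>v\<in>tangent_space A p. g p (\<phi> p u) (\<phi> p v) = g p u v - \<eta> p u * \<eta> p v)))"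

text \<open>The left-hand side of the first equation is \<open>(\<nabla>\<^sub>X \<phi>) Y\<close>; \<open>D\<close> is the Levi-Civita connection.\<close>

definition kenmotsu ::
    "('a::{t2_space, second_countable_topology}, 'e::euclidean_space) atlas \<Rightarrow>
     ('a \<Rightarrow> 'a tvec \<Rightarrow> 'a tvec) \<Rightarrow> 'a vfield \<Rightarrow> ('a \<Rightarrow> 'a tvec \<Rightarrow> real) \<Rightarrow>
     ('a \<Rightarrow> 'a tvec \<Rightarrow> 'a tvec \<Rightarrow> real) \<Rightarrow> 'a conn \<Rightarrow> bool"
  where "kenmotsu A \<phi> \<xi> \<eta> g D \<longleftrightarrow>
    almost_contact_metric A \<phi> \<xi> \<eta> g \<and> levi_civita A g D \<and>
    (\<forall>X Y. vector_field A X \<longrightarrow> vector_field A Y \<longrightarrow>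
       D X (app_endo \<phi> Y) - app_endo \<phi> (D X Y) =
       app_metric g (app_endo \<phi> X) Y \<odot> \<xi> - app_form \<eta> Y \<odot> app_endo \<phi> X) \<and>
    (\<forall>X. vector_field A X \<longrightarrow> D X \<xi> = X - app_form \<eta> X \<odot> \<xi>)"

definition gen_symmetric_metric_connection ::
    "('a::topological_space, 'e::euclidean_space) atlas \<Rightarrow>
     ('a \<Rightarrow> 'a tvec \<Rightarrow> 'a tvec) \<Rightarrow> ('a \<Rightarrow> 'a tvec \<Rightarrow> real) \<Rightarrow>
     ('a \<Rightarrow> 'a tvec \<Rightarrow> 'a tvec \<Rightarrow> real) \<Rightarrow> ('a \<Rightarrow> real) \<Rightarrow> ('a \<Rightarrow> real) \<Rightarrow> 'a conn \<Rightarrow> bool"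
  where "gen_symmetric_metric_connection A \<phi> \<eta> g \<alpha> \<beta> D \<longleftrightarrow>
    linear_connection A D \<and> parallel_metric A g D \<and>
    (\<forall>X Y. vector_field A X \<longrightarrow> vector_field A Y \<longrightarrow>
       torsion D X Y =
         \<alpha> \<odot> (app_form \<eta> Y \<odot> X - app_form \<eta> X \<odot> Y) +
         \<beta> \<odot> (app_form \<eta> Y \<odot> app_endo \<phi> X - app_form \<eta> X \<odot> app_endo \<phi> Y))"

text \<open>The Lie derivative of \<open>g\<close> along \<open>\<xi>\<close> is written in terms of the connection \<open>D\<close>, which may have
  torsion.\<close>

definition eta_ricci_soliton ::
    "('a::topological_space, 'e::euclidean_space) atlas \<Rightarrow> 'a conn \<Rightarrow>
     'a vfield \<Rightarrow> ('a \<Rightarrow> 'a tvec \<Rightarrow> real) \<Rightarrow> ('a \<Rightarrow> 'a tvec \<Rightarrow> 'a tvec \<Rightarrow> real) \<Rightarrow>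
     real \<Rightarrow> real \<Rightarrow> bool"
  where "eta_ricci_soliton A D \<xi> \<eta> g l m \<longleftrightarrow>
    (\<forall>X Y. vector_field A X \<longrightarrow> vector_field A Y \<longrightarrow>
       (\<forall>p. app_metric g (D X \<xi>) Y p + app_metric g X (D Y \<xi>) p + 2 * ricci A D X Y p
            + 2 * l * app_metric g X Y p + 2 * m * app_form \<eta> X p * app_form \<eta> Y p = 0))"

text \<open>The condition usually written \<open>S \<cdot> W\<^sub>2(\<xi>, X) = 0\<close>.\<close>

definition S_dot_W2_zero ::
    "('a::topological_space, 'e::euclidean_space) atlas \<Rightarrow>
     ('a \<Rightarrow> 'a tvec \<Rightarrow> 'a tvec \<Rightarrow> real) \<Rightarrow> 'a conn \<Rightarrow> 'a vfield \<Rightarrow> bool"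
  where "S_dot_W2_zero A g D \<xi> \<longleftrightarrow>
    (let S = ricci A D; W = W2_curvature A g D in
     \<forall>X Y Z V. vector_field A X \<longrightarrow> vector_field A Y \<longrightarrow> vector_field A Z \<longrightarrow> vector_field A V \<longrightarrow>
       S X (W Y Z V) \<odot> \<xi> - S \<xi> (W Y Z V) \<odot> X
       + S X Y \<odot> W \<xi> Z V - S \<xi> Y \<odot> W X Z V
       + S X Z \<odot> W Y \<xi> V - S \<xi> Z \<odot> W Y X V
       + S X V \<odot> W Y Z \<xi> - S \<xi> V \<odot> W Y Z X = 0)"

end

(* Write D for the generalized symmetric metric connection, a = alpha + 1, s = l + a, t = l + m and
   P X = X - eta(X) xi.  Comparing D with the Levi-Civita connection gives D_X xi = a P X, hence
     R(X,Y) xi = X(a) P Y - Y(a) P X + a (eta(X) Y - eta(Y) X + beta (eta(Y) phi X - eta(X) phi Y)),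
   because D preserves g, so that d eta = 0 although D has torsion.  Tracing (phi is skew, hence
   trace-free) and comparing S(Y,xi) with the soliton equation S = -s g + (s - t) eta (x) eta gives
   (P Y)(a) = 0 and xi(a) = t / 2n - a.  For X, Y orthogonal to xi and Z = V = xi, the
   xi-component of S.W2 = 0 reads
     s (s - t) / 2n g(X,Y) + a beta (s + t) g(X, phi Y) = 0.
   Taking Y = X and then X = phi Y yields s (s - t) = 0 and a beta (s + t) = 0.
   Differentiating the former along xi forces xi(a) = 0, so a = t / 2n, and with this s (s - t) = 0
   becomes the first claim.

   Traces and the pointwise meaning of tensorial operators require that the space of derivations at a
   point has the dimension of the model space (Hadamard's lemma) and that tangent vectors extend to
   vector fields (bump functions). *)

theory Submission
  imports Defs
begin

section \<open>Smooth functions on Euclidean spaces\<close>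

text \<open>The functions \<alpha> and \<beta> need not be constant, so derivatives of
  \<open>a\<close> enter the curvature. The full curvature is never written out; R(X,Y)\<xi>
  suffices. Its trace in X gives S(Y,\<xi>), the soliton equation gives all of S and with it the
  Ricci operator, and the one further component that occurs, \<eta>(R(Y,\<xi>)X), equals -g(X,
  R(Y,\<xi>)\<xi>) because D preserves g. Putting Z = V = \<xi> with X and Y horizontal confines the
  condition to these known quantities. \<beta> enters R(X,Y)\<xi> only through the torsion, since
  \<phi> \<xi> = 0 keeps it out of D_X \<xi>.\<close>

lemma C_diff_cong:
  assumes "open U" "\<And>x. x \<in> U \<Longrightarrow> f x = g x" "C_diff k U f"
  shows "C_diff k U g"
  using assms
proof (induction k arbitrary: f g)
  case 0
  then show ?case by (auto cong: continuous_on_cong)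
next
  case (Suc k)
  have d: "f differentiable at x" if "x \<in> U" for x
    using Suc.prems that by auto
  have d': "g differentiable at x" if "x \<in> U" for x
    using d[OF that] has_derivative_transform_within_open[of f _ x UNIV U g]
      Suc.prems(1,2) that unfolding differentiable_def by blast
  have e: "frechet_derivative f (at x) v = frechet_derivative g (at x) v" if "x \<in> U" for x v
    using frechet_derivative_transform_within_open[OF d[OF that] Suc.prems(1) that Suc.prems(2)]
    by simp
  have "C_diff k U (\<lambda>x. frechet_derivative g (at x) v)" for v
    by (rule Suc.IH[OF Suc.prems(1) e]) (use Suc.prems in auto)
  with d' show ?case by auto
qed

text \<open>The inductions on \<open>k\<close> below rest on this: openness of \<open>U\<close>
  makes an explicit derivative agree with the choice term \<open>frechet_derivative\<close> near
  every point, so calculus rules can supply the next order.\<close>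

lemma C_diff_SucI:
  assumes "open U" "\<And>x. x \<in> U \<Longrightarrow> (f has_derivative f' x) (at x)"
    "\<And>v. C_diff k U (\<lambda>x. f' x v)"
  shows "C_diff (Suc k) U f"
proof -
  have "C_diff k U (\<lambda>x. frechet_derivative f (at x) v)" for v
    by (rule C_diff_cong[OF assms(1) _ assms(3)[of v]])
      (simp add: frechet_derivative_at[OF assms(2), symmetric])
  then show ?thesis using assms(2) by (auto simp: differentiable_def)
qed

lemma C_diff_subset: "C_diff k U f \<Longrightarrow> V \<subseteq> U \<Longrightarrow> C_diff k V f"
  by (induction k arbitrary: f) (auto intro: continuous_on_subset)

lemma C_diff_local:
  assumes "\<And>x. x \<in> U \<Longrightarrow> \<exists>V. open V \<and> x \<in> V \<and> C_diff k V f"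
  shows "C_diff k U f"
  using assms
proof (induction k arbitrary: f)
  case 0
  have "continuous (at x) f" if x: "x \<in> U" for x
  proof -
    obtain V where "open V" "x \<in> V" "continuous_on V f" using 0[OF x] by auto
    then show ?thesis by (simp add: continuous_on_eq_continuous_at)
  qed
  then show ?case by (auto intro: continuous_at_imp_continuous_on)
next
  case (Suc k)
  have "f differentiable at x" if x: "x \<in> U" for x
    using Suc.prems[OF x] by auto
  moreover have "C_diff k U (\<lambda>x. frechet_derivative f (at x) v)" for v
    by (rule Suc.IH) (use Suc.prems in fastforce)
  ultimately show ?case by auto
qed

lemma C_diff_continuous_on: "C_diff k U f \<Longrightarrow> continuous_on U f"
  by (cases k)
    (auto intro!: continuous_at_imp_continuous_on differentiable_imp_continuous_within)

lemma C_diff_Suc_D: "C_diff (Suc k) U f \<Longrightarrow> C_diff k U f"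
proof (induction k arbitrary: f)
  case 0
  then show ?case using C_diff_continuous_on by fastforce
next
  case (Suc k)
  then show ?case by auto
qed

lemma C_diff_const: "C_diff k U (\<lambda>x. c)"
  by (induction k arbitrary: c) auto

lemma C_diff_bounded_linear_compose:
  assumes "bounded_linear L" "open U" "C_diff k U f"
  shows "C_diff k U (\<lambda>x. L (f x))"
  using assms(3)
proof (induction k arbitrary: f)
  case 0
  then show ?case
    using bounded_linear.continuous_on[OF assms(1)] by auto
next
  case (Suc k)
  have D: "((\<lambda>x. L (f x)) has_derivative (\<lambda>v. L (frechet_derivative f (at x) v))) (at x)"
    if "x \<in> U" for x
    using Suc.prems that
    by (auto intro!: bounded_linear.has_derivative[OF assms(1)] simp: frechet_derivative_works[symmetric])
  show ?case
    by (rule C_diff_SucI[OF assms(2) D]) (use Suc.IH Suc.prems in auto)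
qed

lemma C_diff_add:
  assumes "open U" "C_diff k U f" "C_diff k U g"
  shows "C_diff k U (\<lambda>x. f x + g x)"
  using assms(2,3)
proof (induction k arbitrary: f g)
  case 0
  then show ?case by (auto intro: continuous_intros)
next
  case (Suc k)
  have D: "((\<lambda>x. f x + g x) has_derivative
      (\<lambda>v. frechet_derivative f (at x) v + frechet_derivative g (at x) v)) (at x)"
    if "x \<in> U" for x
    using Suc.prems that
    by (auto intro!: derivative_intros simp: frechet_derivative_works[symmetric])
  show ?case
    by (rule C_diff_SucI[OF assms(1) D]) (use Suc.IH Suc.prems in auto)
qed

lemma C_diff_mult:
  fixes f g :: "'e::euclidean_space \<Rightarrow> real"
  assumes "open U" "C_diff k U f" "C_diff k U g"
  shows "C_diff k U (\<lambda>x. f x * g x)"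
  using assms(2,3)
proof (induction k arbitrary: f g)
  case 0
  then show ?case by (auto intro: continuous_intros)
next
  case (Suc k)
  have D: "((\<lambda>x. f x * g x) has_derivative
      (\<lambda>v. f x * frechet_derivative g (at x) v + frechet_derivative f (at x) v * g x)) (at x)"
    if "x \<in> U" for x
    using Suc.prems that
    by (auto intro!: derivative_intros simp: frechet_derivative_works[symmetric])
  have E: "C_diff k U (\<lambda>x. f x * frechet_derivative g (at x) v + frechet_derivative f (at x) v * g x)" for v
    by (rule C_diff_add[OF assms(1)]; rule Suc.IH) (use Suc.prems C_diff_Suc_D in auto)
  show ?case by (rule C_diff_SucI[OF assms(1) D E])
qed

lemma C_diff_sum:
  assumes "open U" "\<And>i. i \<in> I \<Longrightarrow> C_diff k U (f i)"
  shows "C_diff k U (\<lambda>x. \<Sum>i\<in>I. f i x)"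
  using assms(2)
  by (induction I rule: infinite_finite_induct) (auto intro!: C_diff_add C_diff_const assms(1))

lemma C_diff_ident: "C_diff k U (\<lambda>x. x)"
  by (cases k) (auto intro: C_diff_const)

lemma C_diff_compose:
  fixes f :: "'e::euclidean_space \<Rightarrow> 'f::euclidean_space" and g :: "'f \<Rightarrow> real"
  assumes "open U" "open V" "C_diff k U f" "C_diff k V g" "f ` U \<subseteq> V"
  shows "C_diff k U (\<lambda>x. g (f x))"
  using assms(3,4)
proof (induction k arbitrary: g)
  case 0
  then show ?case using assms(5) by (auto intro: continuous_on_compose2)
next
  case (Suc k)
  have dg: "g differentiable at (f x)" if "x \<in> U" for x
    using Suc.prems assms(5) that by auto
  have D: "((\<lambda>x. g (f x)) has_derivative
      (\<lambda>v. frechet_derivative g (at (f x)) (frechet_derivative f (at x) v))) (at x)"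
    if "x \<in> U" for x
  proof -
    have "(f has_derivative frechet_derivative f (at x)) (at x)"
      using Suc.prems(1) that frechet_derivative_works by auto
    moreover have "(g has_derivative frechet_derivative g (at (f x))) (at (f x))"
      using dg[OF that] frechet_derivative_works by auto
    ultimately show ?thesis by (rule has_derivative_compose)
  qed
  \<comment> \<open>The direction in which \<open>g\<close> is differentiated varies with
    \<open>x\<close>; expanding it in \<open>Basis\<close> leaves fixed directions \<open>b\<close>,
    to which the induction hypothesis for \<open>g\<close> applies.\<close>
  have E: "frechet_derivative g (at (f x)) w =
      (\<Sum>b\<in>Basis. (w \<bullet> b) * frechet_derivative g (at (f x)) b)" if "x \<in> U" for x w
  proof -
    have "linear (frechet_derivative g (at (f x)))"
      using dg[OF that] linear_frechet_derivative by blast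
    then have "frechet_derivative g (at (f x)) (\<Sum>b\<in>Basis. (w \<bullet> b) *\<^sub>R b) =
        (\<Sum>b\<in>Basis. (w \<bullet> b) * frechet_derivative g (at (f x)) b)"
      by (simp add: linear_sum linear_cmul)
    then show ?thesis by (simp add: euclidean_representation)
  qed
  have F: "C_diff k U (\<lambda>x. \<Sum>b\<in>Basis. (frechet_derivative f (at x) v \<bullet> b) *
      frechet_derivative g (at (f x)) b)" for v
  proof (intro C_diff_sum C_diff_mult assms)
    fix b :: 'f
    show "C_diff k U (\<lambda>x. frechet_derivative f (at x) v \<bullet> b)"
      by (rule C_diff_bounded_linear_compose[OF bounded_linear_inner_left assms(1)])
        (use Suc.prems in auto)
    show "C_diff k U (\<lambda>x. frechet_derivative g (at (f x)) b)"
      by (rule Suc.IH) (use Suc.prems C_diff_Suc_D in auto)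
  qed
  show ?case
    by (rule C_diff_SucI[OF assms(1) D]) (simp_all add: E C_diff_cong[OF assms(1) _ F])
qed

section \<open>Closure rules for functions smooth to all orders\<close>

lemma smooth_on_cong:
  assumes "open U" "\<And>x. x \<in> U \<Longrightarrow> f x = g x" "smooth_on U f"
  shows "smooth_on U g"
  unfolding smooth_on_def
  by (intro allI C_diff_cong[OF assms(1,2)]) (use assms(3) in \<open>unfold smooth_on_def, blast+\<close>)

lemma smooth_on_subset: "smooth_on U f \<Longrightarrow> V \<subseteq> U \<Longrightarrow> smooth_on V f"
  unfolding smooth_on_def using C_diff_subset by blast

lemma smooth_on_local:
  assumes "\<And>x. x \<in> U \<Longrightarrow> \<exists>V. open V \<and> x \<in> V \<and> smooth_on V f"
  shows "smooth_on U f"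
  unfolding smooth_on_def
proof
  fix k
  show "C_diff k U f"
    by (rule C_diff_local) (use assms in \<open>force simp: smooth_on_def\<close>)
qed

lemma smooth_on_const: "smooth_on U (\<lambda>x. c)"
  by (simp add: smooth_on_def C_diff_const)

lemma smooth_on_ident: "smooth_on U (\<lambda>x. x)"
  by (simp add: smooth_on_def C_diff_ident)

lemma smooth_on_bounded_linear:
  assumes "bounded_linear L" "open U" "smooth_on U f"
  shows "smooth_on U (\<lambda>x. L (f x))"
  unfolding smooth_on_def
  by (intro allI C_diff_bounded_linear_compose[OF assms(1,2)]) (use assms(3) in \<open>unfold smooth_on_def, blast+\<close>)

lemma smooth_on_add:
  assumes "open U" "smooth_on U f" "smooth_on U g"
  shows "smooth_on U (\<lambda>x. f x + g x)"
  unfolding smooth_on_def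
  by (intro allI C_diff_add[OF assms(1)]) (use assms(2,3) in \<open>unfold smooth_on_def, blast+\<close>)

lemma smooth_on_mult:
  fixes f g :: "'e::euclidean_space \<Rightarrow> real"
  assumes "open U" "smooth_on U f" "smooth_on U g"
  shows "smooth_on U (\<lambda>x. f x * g x)"
  unfolding smooth_on_def
  by (intro allI C_diff_mult[OF assms(1)]) (use assms(2,3) in \<open>unfold smooth_on_def, blast+\<close>)

lemma smooth_on_sum:
  assumes "open U" "\<And>i. i \<in> I \<Longrightarrow> smooth_on U (f i)"
  shows "smooth_on U (\<lambda>x. \<Sum>i\<in>I. f i x)"
  unfolding smooth_on_def
  by (intro allI C_diff_sum[OF assms(1)]) (use assms(2) in \<open>unfold smooth_on_def, blast+\<close>)

lemma smooth_on_compose: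
  fixes f :: "'e::euclidean_space \<Rightarrow> 'f::euclidean_space" and g :: "'f \<Rightarrow> real"
  assumes "open U" "open V" "smooth_on U f" "smooth_on V g" "f ` U \<subseteq> V"
  shows "smooth_on U (\<lambda>x. g (f x))"
  unfolding smooth_on_def
proof
  fix k
  show "C_diff k U (\<lambda>x. g (f x))"
    by (rule C_diff_compose[OF assms(1,2) _ _ assms(5)])
      (use assms(3,4) in \<open>unfold smooth_on_def, blast+\<close>)
qed

lemma smooth_on_frechet_derivative:
  assumes "smooth_on U f"
  shows "smooth_on U (\<lambda>x. frechet_derivative f (at x) v)"
  unfolding smooth_on_def
proof
  fix k
  have "C_diff (Suc k) U f" using assms unfolding smooth_on_def by blast
  then show "C_diff k U (\<lambda>x. frechet_derivative f (at x) v)" by simp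
qed

lemma smooth_on_differentiable:
  assumes "smooth_on U f" "x \<in> U"
  shows "f differentiable at x"
proof -
  have "C_diff (Suc 0) U f" using assms unfolding smooth_on_def by blast
  with assms(2) show ?thesis by simp
qed

lemma smooth_on_continuous_on: "smooth_on U f \<Longrightarrow> continuous_on U f"
  unfolding smooth_on_def using C_diff_continuous_on by blast

text \<open>The family \<open>x\<^sup>-\<^sup>n exp (- 1 / x)\<close>, extended by \<open>0\<close>, is closed under differentiation up to
  linear combinations.\<close>

definition flat_exp :: "nat \<Rightarrow> real \<Rightarrow> real"
  where "flat_exp n x = (if x > 0 then exp (- inverse x) * inverse x ^ n else 0)"

lemma flat_exp_tendsto_0: "(flat_exp n \<longlongrightarrow> 0) (at 0)"
proof -
  have "((\<lambda>y::real. y ^ n / exp y) \<longlongrightarrow> 0) at_top" for n :: nat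
    by (rule tendsto_power_div_exp_0)
  then have "((\<lambda>x::real. inverse x ^ n / exp (inverse x)) \<longlongrightarrow> 0) (at_right 0)"
    by (rule filterlim_compose[OF _ filterlim_inverse_at_top_right])
  moreover have "\<forall>\<^sub>F x in at_right 0. inverse x ^ n / exp (inverse x) = flat_exp n x"
    by (auto simp: eventually_at_filter flat_exp_def exp_minus field_simps)
  ultimately have "(flat_exp n \<longlongrightarrow> 0) (at_right 0)"
    using tendsto_cong by fastforce
  moreover have "\<forall>\<^sub>F x in at_left 0. 0 = flat_exp n x"
    by (auto simp: eventually_at_filter flat_exp_def)
  then have "(flat_exp n \<longlongrightarrow> 0) (at_left 0)"
    using tendsto_cong tendsto_const by fastforce
  ultimately show ?thesis by (simp add: filterlim_at_split)
qed

lemma flat_exp_deriv: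
  "(flat_exp n has_real_derivative flat_exp (n + 2) x - n * flat_exp (n + 1) x) (at x)"
proof (cases x "0::real" rule: linorder_cases)
  case less
  have "((\<lambda>x. 0) has_real_derivative 0) (at x)" by simp
  then have "(flat_exp n has_real_derivative 0) (at x)"
    by (rule has_field_derivative_transform_within_open[of _ _ _ "{..<0}"])
      (use less in \<open>auto simp: flat_exp_def\<close>)
  then show ?thesis using less by (simp add: flat_exp_def)
next
  case equal
  \<comment> \<open>The difference quotient of \<open>flat_exp n\<close> at 0 is
    \<open>flat_exp (Suc n)\<close> itself, as \<open>flat_exp n 0 = 0\<close>.\<close>
  have "((\<lambda>h. (flat_exp n (0 + h) - flat_exp n 0) / h) \<longlongrightarrow> 0) (at 0)"
  proof (rule Lim_transform_eventually[OF flat_exp_tendsto_0[of "Suc n"]])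
    show "\<forall>\<^sub>F h in at 0. flat_exp (Suc n) h = (flat_exp n (0 + h) - flat_exp n 0) / h"
      by (auto simp: eventually_at_filter flat_exp_def field_simps)
  qed
  then show ?thesis using equal by (simp add: DERIV_def flat_exp_def)
next
  case greater
  have "((\<lambda>x. exp (- inverse x) * inverse x ^ n) has_real_derivative
      flat_exp (n + 2) x - n * flat_exp (n + 1) x) (at x)"
    using greater
    by (cases n, auto intro!: derivative_eq_intros simp: flat_exp_def power2_eq_square field_simps)
      (metis Suc_pred not_gr0 power_Suc)
  then show ?thesis
    by (rule has_field_derivative_transform_within_open[of _ _ _ "{0<..}"])
      (use greater in \<open>auto simp: flat_exp_def\<close>)
qed

lemma C_diff_flat_exp: "C_diff k UNIV (flat_exp n)"
proof (induction k arbitrary: n)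
  case 0
  have "isCont (flat_exp n) x" for x
    using flat_exp_deriv DERIV_isCont by blast
  then show ?case by (auto intro: continuous_at_imp_continuous_on)
next
  case (Suc k)
  have D: "(flat_exp n has_derivative (\<lambda>v. (flat_exp (n + 2) x - n * flat_exp (n + 1) x) * v)) (at x)" for x
    using flat_exp_deriv[of n x] by (simp add: has_field_derivative_def)
  have "C_diff k UNIV (\<lambda>x. (flat_exp (n + 2) x + (- real n) * flat_exp (n + 1) x) * v)" for v
    by (intro C_diff_mult C_diff_add C_diff_const Suc.IH) auto
  then show ?case by (intro C_diff_SucI[OF open_UNIV D]) auto
qed

lemma smooth_flat_exp: "smooth_on UNIV (flat_exp n)"
  by (simp add: smooth_on_def C_diff_flat_exp)

lemma smooth_bump_euclidean:
  fixes x0 :: "'e::euclidean_space"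
  assumes "r > 0"
  obtains b :: "'e \<Rightarrow> real" where "smooth_on UNIV b" "b x0 = 1" "\<And>x. x \<notin> cball x0 r \<Longrightarrow> b x = 0"
proof
  \<comment> \<open>This is \<open>r\<^sup>2\<close> minus the squared distance from
    \<open>x0\<close>, written with coordinates, sums and products so that the closure rules apply;
    \<open>flat_exp 0\<close> cuts it off where it is negative.\<close>
  let ?q = "\<lambda>x. r\<^sup>2 + (\<Sum>i\<in>Basis. (-1) * (((x \<bullet> i) + - (x0 \<bullet> i)) * ((x \<bullet> i) + - (x0 \<bullet> i))))"
  let ?b = "\<lambda>x. inverse (flat_exp 0 (r\<^sup>2)) * flat_exp 0 (?q x)"
  have "smooth_on UNIV ?q"
    by (intro smooth_on_mult smooth_on_add smooth_on_sum smooth_on_const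
        smooth_on_bounded_linear[OF bounded_linear_inner_left] smooth_on_ident) auto
  then show "smooth_on UNIV ?b"
    by (intro smooth_on_mult smooth_on_const smooth_on_compose[OF _ _ _ smooth_flat_exp]) auto
  show "?b x0 = 1" using assms by (simp add: flat_exp_def)
  show "?b x = 0" if "x \<notin> cball x0 r" for x
  proof -
    have "(\<Sum>i\<in>Basis. ((x \<bullet> i) - (x0 \<bullet> i)) * ((x \<bullet> i) - (x0 \<bullet> i))) = (dist x0 x)\<^sup>2"
    proof -
      have "(dist x0 x)\<^sup>2 = (\<Sum>i\<in>Basis. (dist (x0 \<bullet> i) (x \<bullet> i))\<^sup>2)"
        by (subst euclidean_dist_l2) (simp add: L2_set_def sum_nonneg)
      then show ?thesis by (simp add: dist_real_def power2_eq_square algebra_simps)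
    qed
    moreover have "r\<^sup>2 < (dist x0 x)\<^sup>2" using that assms by (auto intro: power_strict_mono)
    ultimately have "?q x < 0" by (simp add: sum_negf)
    then show ?thesis by (simp add: flat_exp_def)
  qed
qed

text \<open>Each differentiation under the integral sign produces a factor \<open>t\<close> by the
  chain rule, so the induction must admit an arbitrary weight \<open>t ^ j\<close>. Convexity keeps
  the segment inside \<open>S\<close>.\<close>

lemma C_diff_integral_segment:
  fixes f :: "'e::euclidean_space \<Rightarrow> real"
  assumes "open S" "convex S" "x0 \<in> S" "C_diff k S f"
  shows "C_diff k S (\<lambda>x. integral {0..1} (\<lambda>t. t ^ j * f (x0 + t *\<^sub>R (x - x0))))"
  using assms(4)
proof (induction k arbitrary: f j)
  have seg: "x0 + t *\<^sub>R (x - x0) \<in> S" if "x \<in> S" "t \<in> {0..1}" for x t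
    using convexD_alt[OF assms(2,3) that(1)] that(2) by (simp add: algebra_simps)
  have cont: "continuous_on (S \<times> cbox 0 1) (\<lambda>(x, t). t ^ j * f (x0 + t *\<^sub>R (x - x0)))"
    if f: "continuous_on S f" for j and f :: "'e \<Rightarrow> real"
    unfolding split_beta
    by (intro continuous_intros continuous_on_compose2[OF f]) (use seg in auto)
  {
    case 0
    then show ?case using integral_continuous_on_param[OF cont[of f j]] by simp
  next
    case (Suc k)
    let ?G = "\<lambda>f j x. integral {0..1} (\<lambda>t. t ^ j * f (x0 + t *\<^sub>R (x - x0)))"
    let ?D = "\<lambda>v x. frechet_derivative f (at x) v"
    have bl: "bounded_linear (frechet_derivative f (at x))" if "x \<in> S" for x
      using Suc.prems that by (auto simp: frechet_derivative_works intro: has_derivative_bounded_linear)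
    \<comment> \<open>\<open>leibniz_rule\<close> takes the derivative of the integrand as an
      operator-valued function. \<open>Blinfun\<close> has the intended meaning only where its
      argument is bounded linear, hence the restriction on \<open>x\<close> and \<open>t\<close> in
      the next fact.\<close>
    define fx where "fx = (\<lambda>x t. Blinfun (\<lambda>v. t ^ Suc j * ?D v (x0 + t *\<^sub>R (x - x0))))"
    have fx: "blinfun_apply (fx x t) = (\<lambda>v. t ^ Suc j * ?D v (x0 + t *\<^sub>R (x - x0)))"
      if "x \<in> S" "t \<in> {0..1}" for x t
      unfolding fx_def
      by (rule bounded_linear_Blinfun_apply)
        (intro bounded_linear_const_mult bl seg that)
    \<comment> \<open>In finite dimension, continuity of an operator-valued map may be checked on
      basis vectors, where \<open>cont\<close> applies with weight \<open>t ^ Suc j\<close>.\<close>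
    have contfx: "continuous_on (S \<times> cbox 0 1) (\<lambda>(x, t). fx x t)"
    proof (rule continuous_on_blinfun_componentwise)
      fix i :: 'e
      have "continuous_on S (?D i)" using Suc.prems C_diff_continuous_on by fastforce
      from cont[OF this, of "Suc j"]
      show "continuous_on (S \<times> cbox 0 1) (\<lambda>x. blinfun_apply (case x of (x, t) \<Rightarrow> fx x t) i)"
        by (rule continuous_on_eq) (auto simp: fx)
    qed
    have D: "(?G f j has_derivative (\<lambda>v. ?G (?D v) (Suc j) x)) (at x)" if x: "x \<in> S" for x
    proof -
      have "((\<lambda>x. integral (cbox 0 1) (\<lambda>t. t ^ j * f (x0 + t *\<^sub>R (x - x0)))) has_derivative
          blinfun_apply (integral (cbox 0 1) (fx x))) (at x within S)"
      proof (rule leibniz_rule[OF _ _ contfx x assms(2)])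
        fix y t assume yt: "y \<in> S" "t \<in> cbox (0::real) 1"
        then have "f differentiable at (x0 + t *\<^sub>R (y - x0))"
          using seg Suc.prems by auto
        then have "(f has_derivative frechet_derivative f (at (x0 + t *\<^sub>R (y - x0))))
            (at (x0 + t *\<^sub>R (y - x0)))"
          by (simp add: frechet_derivative_works)
        then have "((\<lambda>y. f (x0 + t *\<^sub>R (y - x0))) has_derivative
            (\<lambda>v. frechet_derivative f (at (x0 + t *\<^sub>R (y - x0))) (t *\<^sub>R v))) (at y within S)"
          by (rule has_derivative_compose[rotated]) (auto intro!: derivative_eq_intros)
        then have "((\<lambda>y. t ^ j * f (x0 + t *\<^sub>R (y - x0))) has_derivative
            (\<lambda>v. t ^ j * frechet_derivative f (at (x0 + t *\<^sub>R (y - x0))) (t *\<^sub>R v))) (at y within S)"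
          by (rule has_derivative_mult_right)
        moreover have "linear (frechet_derivative f (at (x0 + t *\<^sub>R (y - x0))))"
          using bl seg yt by (simp add: bounded_linear.linear)
        ultimately show "((\<lambda>y. t ^ j * f (x0 + t *\<^sub>R (y - x0))) has_derivative blinfun_apply (fx y t))
            (at y within S)"
          using yt by (simp add: fx linear_cmul mult.assoc mult.left_commute)
      next
        fix y assume "y \<in> S"
        then have "(\<lambda>t. (y, t)) ` cbox 0 1 \<subseteq> S \<times> cbox (0::real) 1" by auto
        moreover have "continuous_on (cbox (0::real) 1) (\<lambda>t. (y, t))"
          by (intro continuous_intros)
        ultimately have "continuous_on (cbox 0 1) (\<lambda>t. t ^ j * f (x0 + t *\<^sub>R (y - x0)))"
          using continuous_on_compose2[OF cont[OF C_diff_continuous_on[OF Suc.prems], of j],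
              of "cbox 0 1" "\<lambda>t. (y, t)"]
          by simp
        then show "(\<lambda>t. t ^ j * f (x0 + t *\<^sub>R (y - x0))) integrable_on cbox 0 1"
          by (rule integrable_continuous)
      qed
      moreover have "blinfun_apply (integral (cbox 0 1) (fx x)) = (\<lambda>v. ?G (?D v) (Suc j) x)"
      proof (rule ext)
        fix v
        have "(\<lambda>t. (x, t)) ` cbox 0 1 \<subseteq> S \<times> cbox (0::real) 1" using x by auto
        moreover have "continuous_on (cbox (0::real) 1) (\<lambda>t. (x, t))"
          by (intro continuous_intros)
        ultimately have "continuous_on (cbox 0 1) (fx x)"
          using continuous_on_compose2[OF contfx, of "cbox 0 1" "\<lambda>t. (x, t)"] by simp
        then have i: "fx x integrable_on cbox 0 1" by (rule integrable_continuous)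
        have "blinfun_apply (integral (cbox 0 1) (fx x)) v = integral (cbox 0 1) (\<lambda>t. fx x t v)"
          using blinfun_apply_integral[OF i] by simp
        also have "\<dots> = ?G (?D v) (Suc j) x"
          by (simp only: interval_cbox[symmetric], rule integral_cong) (use fx x in auto)
        finally show "blinfun_apply (integral (cbox 0 1) (fx x)) v = ?G (?D v) (Suc j) x" .
      qed
      ultimately show ?thesis
        using at_within_open[OF x assms(1)] by simp
    qed
    have E: "C_diff k S (\<lambda>x. ?G (?D v) (Suc j) x)" for v
      by (rule Suc.IH) (use Suc.prems in auto)
    show ?case by (rule C_diff_SucI[OF assms(1) D E])
  }
qed

text \<open>Integrate the derivative of \<open>f\<close> along the segment from \<open>x0\<close> to
  \<open>x\<close> and expand the direction \<open>x - x0\<close> in \<open>Basis\<close>: the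
  factor \<open>h b\<close> is the mean of the \<open>b\<close>-derivative over the segment, so its
  value at \<open>x0\<close> is that derivative.\<close>

lemma Hadamard:
  fixes f :: "'e::euclidean_space \<Rightarrow> real"
  assumes "open S" "convex S" "x0 \<in> S" "smooth_on S f"
  shows "\<exists>h. (\<forall>b. smooth_on S (h b) \<and> h b x0 = frechet_derivative f (at x0) b) \<and>
    (\<forall>x\<in>S. f x = f x0 + (\<Sum>b\<in>Basis. ((x - x0) \<bullet> b) * h b x))"
proof -
  let ?D = "\<lambda>b x. frechet_derivative f (at x) b"
  let ?h = "\<lambda>b x. integral {0..1} (\<lambda>t. t ^ 0 * ?D b (x0 + t *\<^sub>R (x - x0)))"
  have seg: "x0 + t *\<^sub>R (x - x0) \<in> S" if "x \<in> S" "t \<in> {0..1}" for x t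
    using convexD_alt[OF assms(2,3) that(1)] that(2) by (simp add: algebra_simps)
  have df: "f differentiable at x" if "x \<in> S" for x
    using assms(4) that smooth_on_differentiable by blast
  have 1: "smooth_on S (?h b)" for b
    using C_diff_integral_segment[OF assms(1-3)] smooth_on_frechet_derivative[OF assms(4)]
    unfolding smooth_on_def by blast
  have 2: "f x = f x0 + (\<Sum>b\<in>Basis. ((x - x0) \<bullet> b) * ?h b x)" if x: "x \<in> S" for x
  proof -
    have "((\<lambda>t. ?D (x - x0) (x0 + t *\<^sub>R (x - x0))) has_integral
        f (x0 + 1 *\<^sub>R (x - x0)) - f (x0 + 0 *\<^sub>R (x - x0))) {0..1}"
    proof (rule fundamental_theorem_of_calculus)
      fix t :: real assume t: "t \<in> {0..1}"
      have d: "f differentiable at (x0 + t *\<^sub>R (x - x0))" using df seg[OF x t] by blast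
      then have "(f has_derivative frechet_derivative f (at (x0 + t *\<^sub>R (x - x0)))) (at (x0 + t *\<^sub>R (x - x0)))"
        by (simp add: frechet_derivative_works)
      then have "((\<lambda>t. f (x0 + t *\<^sub>R (x - x0))) has_derivative
          (\<lambda>h. frechet_derivative f (at (x0 + t *\<^sub>R (x - x0))) (h *\<^sub>R (x - x0)))) (at t within {0..1})"
        by (rule has_derivative_compose[rotated]) (auto intro!: derivative_eq_intros)
      then show "((\<lambda>t. f (x0 + t *\<^sub>R (x - x0))) has_vector_derivative
          ?D (x - x0) (x0 + t *\<^sub>R (x - x0))) (at t within {0..1})"
        using linear_frechet_derivative[OF d] by (simp add: has_vector_derivative_def linear_cmul)
    qed simp
    then have "f x - f x0 = integral {0..1} (\<lambda>t. ?D (x - x0) (x0 + t *\<^sub>R (x - x0)))"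
      by (simp add: integral_unique)
    also have "\<dots> = integral {0..1} (\<lambda>t. \<Sum>b\<in>Basis. ((x - x0) \<bullet> b) * ?D b (x0 + t *\<^sub>R (x - x0)))"
    proof (rule integral_cong)
      fix t :: real assume t: "t \<in> {0..1}"
      have "linear (frechet_derivative f (at (x0 + t *\<^sub>R (x - x0))))"
        using df seg[OF x t] linear_frechet_derivative by blast
      then have "frechet_derivative f (at (x0 + t *\<^sub>R (x - x0))) (\<Sum>b\<in>Basis. ((x - x0) \<bullet> b) *\<^sub>R b) =
          (\<Sum>b\<in>Basis. ((x - x0) \<bullet> b) * ?D b (x0 + t *\<^sub>R (x - x0)))"
        by (simp add: linear_sum linear_cmul)
      then show "?D (x - x0) (x0 + t *\<^sub>R (x - x0)) =
          (\<Sum>b\<in>Basis. ((x - x0) \<bullet> b) * ?D b (x0 + t *\<^sub>R (x - x0)))"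
        by (simp add: euclidean_representation)
    qed
    also have "\<dots> = (\<Sum>b\<in>Basis. integral {0..1} (\<lambda>t. ((x - x0) \<bullet> b) * ?D b (x0 + t *\<^sub>R (x - x0))))"
    proof (rule integral_sum)
      fix b :: 'e
      have "continuous_on S (?D b)"
        using smooth_on_continuous_on smooth_on_frechet_derivative assms(4) by blast
      then show "(\<lambda>t. ((x - x0) \<bullet> b) * ?D b (x0 + t *\<^sub>R (x - x0))) integrable_on {0..1}"
        by (intro integrable_continuous_real continuous_intros) 
          (auto intro!: continuous_on_compose2[where f="\<lambda>t. x0 + t *\<^sub>R (x - x0)" and t=S] continuous_intros seg x)
    qed simp
    finally show ?thesis by simp
  qed
  show ?thesis
    by (rule exI[of _ ?h]) (use 1 2 in simp)
qed

section \<open>Tangent vectors and vector fields\<close>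

locale smooth_manifold =
  fixes A :: "('a::{t2_space, second_countable_topology}, 'e::euclidean_space) atlas"
  assumes atlas: "smooth_atlas A"
begin

lemma chartD:
  assumes "(U, c) \<in> A"
  shows "open U" "open (c ` U)" "inj_on c U" "homeomorphism U (c ` U) c (inv_into U c)"
  using atlas assms unfolding smooth_atlas_def by blast+

lemma chart_inv [simp]: "(U, c) \<in> A \<Longrightarrow> q \<in> U \<Longrightarrow> inv_into U c (c q) = q"
  using chartD(3) by (simp add: inv_into_f_f)

lemma ex_chart: obtains U c where "(U, c) \<in> A" "p \<in> U"
proof -
  have "p \<in> (\<Union>(U, c)\<in>A. U)" using atlas unfolding smooth_atlas_def by blast
  then show ?thesis using that by blast
qed

lemma transition:
  assumes "(U, c) \<in> A" "(V, d) \<in> A"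
  shows "smooth_on (c ` (U \<inter> V)) (d \<circ> inv_into U c)"
  using atlas assms unfolding smooth_atlas_def by blast

lemma open_chart_image:
  assumes "(U, c) \<in> A" "open W" "W \<subseteq> U"
  shows "open (c ` W)"
proof -
  have "openin (top_of_set U) W" using assms by (simp add: openin_open_eq chartD)
  then have "openin (top_of_set (c ` U)) (c ` W)"
    using homeomorphism_imp_open_map[OF chartD(4)[OF assms(1)]] by blast
  then show ?thesis using openin_open_trans chartD(2)[OF assms(1)] by blast
qed

lemma open_chart_inv_image:
  assumes "(U, c) \<in> A" "open S" "S \<subseteq> c ` U"
  shows "open (inv_into U c ` S)"
proof -
  have "openin (top_of_set (c ` U)) S" using assms by (simp add: openin_open_eq chartD)
  then have "openin (top_of_set U) (inv_into U c ` S)"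
    using homeomorphism_imp_open_map[OF homeomorphism_symD[OF chartD(4)[OF assms(1)]]] by blast
  then show ?thesis using openin_open_trans chartD(1)[OF assms(1)] by blast
qed

lemma C_infD: "f \<in> C_inf A \<Longrightarrow> (U, c) \<in> A \<Longrightarrow> smooth_on (c ` U) (f \<circ> inv_into U c)"
  unfolding C_inf_def by blast

text \<open>One convenient chart near each point is enough: the transition maps of the atlas carry
  smoothness to every other chart.\<close>

lemma C_inf_localI:
  assumes "\<And>p. \<exists>U c W. (U, c) \<in> A \<and> open W \<and> p \<in> W \<and> W \<subseteq> U \<and> smooth_on (c ` W) (f \<circ> inv_into U c)"
  shows "f \<in> C_inf A"
proof -
  have "smooth_on (d ` V) (f \<circ> inv_into V d)" if Vd: "(V, d) \<in> A" for V d
  proof (rule smooth_on_local)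
    fix x assume "x \<in> d ` V"
    then obtain q where q: "q \<in> V" "x = d q" by blast
    obtain U c W where W: "(U, c) \<in> A" "open W" "q \<in> W" "W \<subseteq> U"
      and sm: "smooth_on (c ` W) (f \<circ> inv_into U c)" using assms by blast
    let ?N = "d ` (V \<inter> W)"
    have oN: "open ?N" by (rule open_chart_image[OF Vd]) (use W chartD(1)[OF Vd] in auto)
    have "smooth_on ?N (\<lambda>y. (f \<circ> inv_into U c) ((c \<circ> inv_into V d) y))"
    proof (rule smooth_on_compose[OF oN open_chart_image[OF W(1,2,4)] _ sm])
      show "smooth_on ?N (c \<circ> inv_into V d)"
        by (rule smooth_on_subset[OF transition[OF Vd W(1)]]) (use W in auto)
      show "(c \<circ> inv_into V d) ` ?N \<subseteq> c ` W" using Vd by auto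
    qed
    then have "smooth_on ?N (f \<circ> inv_into V d)"
      by (rule smooth_on_cong[OF oN, rotated]) (use Vd W in auto)
    then show "\<exists>N. open N \<and> x \<in> N \<and> smooth_on N (f \<circ> inv_into V d)"
      using oN q W by blast
  qed
  then show ?thesis unfolding C_inf_def by blast
qed

lemma C_inf_const: "(\<lambda>x. k) \<in> C_inf A"
  unfolding C_inf_def by (auto simp: o_def smooth_on_const)

lemma C_inf_add:
  assumes "f \<in> C_inf A" "h \<in> C_inf A"
  shows "(\<lambda>x. f x + h x) \<in> C_inf A"
proof -
  have "smooth_on (c ` U) ((\<lambda>x. f x + h x) \<circ> inv_into U c)" if "(U, c) \<in> A" for U c
    using smooth_on_add[OF chartD(2)[OF that] C_infD[OF assms(1) that] C_infD[OF assms(2) that]]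
    by (simp add: o_def)
  then show ?thesis unfolding C_inf_def by blast
qed

lemma C_inf_mult:
  assumes "f \<in> C_inf A" "h \<in> C_inf A"
  shows "(\<lambda>x. f x * h x) \<in> C_inf A"
proof -
  have "smooth_on (c ` U) ((\<lambda>x. f x * h x) \<circ> inv_into U c)" if "(U, c) \<in> A" for U c
    using smooth_on_mult[OF chartD(2)[OF that] C_infD[OF assms(1) that] C_infD[OF assms(2) that]]
    by (simp add: o_def)
  then show ?thesis unfolding C_inf_def by blast
qed

lemma C_inf_diff: "f \<in> C_inf A \<Longrightarrow> h \<in> C_inf A \<Longrightarrow> (\<lambda>x. f x - h x) \<in> C_inf A"
  using C_inf_add[of f "\<lambda>x. - 1 * h x"] C_inf_mult[OF C_inf_const[of "-1"], of h] by simp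

lemma C_inf_sum:
  "(\<And>i. i \<in> I \<Longrightarrow> f i \<in> C_inf A) \<Longrightarrow> (\<lambda>x. \<Sum>i\<in>I. f i x) \<in> C_inf A"
  by (induction I rule: infinite_finite_induct) (auto intro: C_inf_add C_inf_const)

text \<open>\<open>W\<close> and the complement of \<open>K\<close> are open and cover the manifold;
  on the latter the function vanishes. This turns coordinate expressions into globally smooth
  functions, the only ones on which a tangent vector can be nonzero.\<close>

lemma bump_mult_C_inf:
  assumes Uc: "(U, c) \<in> A" and W: "open W" "W \<subseteq> U" and K: "closed K" "K \<subseteq> W"
    and b: "b \<in> C_inf A" "\<And>q. q \<notin> K \<Longrightarrow> b q = 0"
    and G: "smooth_on (c ` W) (G \<circ> inv_into U c)"
  shows "(\<lambda>q. if q \<in> W then b q * G q else 0) \<in> C_inf A" (is "?f \<in> _")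
proof (rule C_inf_localI)
  fix p
  show "\<exists>U c W. (U, c) \<in> A \<and> open W \<and> p \<in> W \<and> W \<subseteq> U \<and> smooth_on (c ` W) (?f \<circ> inv_into U c)"
  proof (cases "p \<in> W")
    case True
    have o: "open (c ` W)" by (rule open_chart_image[OF Uc W])
    have "smooth_on (c ` W) (\<lambda>x. (b \<circ> inv_into U c) x * (G \<circ> inv_into U c) x)"
      by (rule smooth_on_mult[OF o smooth_on_subset[OF C_infD[OF b(1) Uc]] G]) (use W in auto)
    then have "smooth_on (c ` W) (?f \<circ> inv_into U c)"
      by (rule smooth_on_cong[OF o, rotated]) (use W Uc in auto)
    then show ?thesis
      by (intro exI[of _ U] exI[of _ c] exI[of _ W]) (use Uc W True in auto)
  next
    case False
    obtain V d where Vd: "(V, d) \<in> A" "p \<in> V" by (rule ex_chart)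
    have o: "open (V - K)" using chartD(1)[OF Vd(1)] K by auto
    have "smooth_on (d ` (V - K)) (?f \<circ> inv_into V d)"
      by (rule smooth_on_cong[OF open_chart_image[OF Vd(1) o] _ smooth_on_const[of _ 0]])
        (use Vd b(2) in auto)
    then show ?thesis
      by (intro exI[of _ V] exI[of _ d] exI[of _ "V - K"]) (use Vd o False K in auto)
  qed
qed

lemma ex_bump:
  assumes Uc: "(U, c) \<in> A" and W: "open W" "p \<in> W" "W \<subseteq> U"
  obtains b K where "b \<in> C_inf A" "closed K" "K \<subseteq> W" "b p = 1" "\<And>q. q \<notin> K \<Longrightarrow> b q = 0"
proof -
  have "open (c ` W)" by (rule open_chart_image[OF Uc W(1,3)])
  then obtain r where r: "r > 0" "cball (c p) r \<subseteq> c ` W"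
    using W by (meson imageI open_contains_cball)
  obtain \<beta> :: "'e \<Rightarrow> real" where \<beta>: "smooth_on UNIV \<beta>" "\<beta> (c p) = 1"
    and \<beta>0: "\<And>x. x \<notin> cball (c p) r \<Longrightarrow> \<beta> x = 0"
    using smooth_bump_euclidean[OF r(1)] by metis
  let ?K = "inv_into U c ` cball (c p) r"
  define b where "b = (\<lambda>q. if q \<in> U then \<beta> (c q) else 0)"
  have sub: "cball (c p) r \<subseteq> c ` U" using r W by auto
  have "continuous_on (c ` U) (inv_into U c)"
    using chartD(4)[OF Uc] unfolding homeomorphism_def by blast
  then have "compact ?K"
    using compact_continuous_image[OF continuous_on_subset[OF _ sub] compact_cball] by blast
  \<comment> \<open>Here the Hausdorff property enters: the compact support is closed, so the
    extension by 0 is smooth outside the chart too.\<close>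
  then have K: "closed ?K" by (rule compact_imp_closed)
  have KW: "?K \<subseteq> W"
  proof
    fix q assume "q \<in> ?K"
    then obtain q' where "q' \<in> W" "q = inv_into U c (c q')" using r by blast
    then show "q \<in> W" using W Uc by auto
  qed
  have b0: "b q = 0" if "q \<notin> ?K" for q
  proof (cases "q \<in> U")
    case True
    then have "c q \<notin> cball (c p) r" using that Uc chart_inv by (metis image_eqI)
    then show ?thesis using \<beta>0 by (simp add: b_def)
  qed (simp add: b_def)
  have "b \<in> C_inf A"
  proof (rule C_inf_localI)
    fix q
    show "\<exists>U c W. (U, c) \<in> A \<and> open W \<and> q \<in> W \<and> W \<subseteq> U \<and> smooth_on (c ` W) (b \<circ> inv_into U c)"
    proof (cases "q \<in> U")
      case True
      have "smooth_on (c ` U) (b \<circ> inv_into U c)"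
        by (rule smooth_on_cong[OF chartD(2)[OF Uc] _ smooth_on_subset[OF \<beta>(1)]])
          (use Uc in \<open>auto simp: b_def\<close>)
      then show ?thesis
        by (intro exI[of _ U] exI[of _ c] exI[of _ U]) (use Uc True chartD(1)[OF Uc] in auto)
    next
      case False
      obtain V d where Vd: "(V, d) \<in> A" "q \<in> V" by (rule ex_chart)
      have o: "open (V - ?K)" using chartD(1)[OF Vd(1)] K by auto
      have "smooth_on (d ` (V - ?K)) (b \<circ> inv_into V d)"
        by (rule smooth_on_cong[OF open_chart_image[OF Vd(1) o] _ smooth_on_const[of _ 0]])
          (use Vd b0 in auto)
      then show ?thesis
        by (intro exI[of _ V] exI[of _ d] exI[of _ "V - ?K"]) (use Vd o False KW W in auto)
    qed
  qed
  moreover have "b p = 1" using W \<beta> by (auto simp: b_def)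
  ultimately show ?thesis using K KW b0 by (intro that[of b ?K])
qed

section \<open>Derivations at a point and the dimension of the tangent space\<close>

lemma tangent_spaceD:
  assumes "v \<in> tangent_space A p"
  shows tv_add: "\<And>f h. f \<in> C_inf A \<Longrightarrow> h \<in> C_inf A \<Longrightarrow> v (\<lambda>x. f x + h x) = v f + v h"
    and tv_scale: "\<And>k f. f \<in> C_inf A \<Longrightarrow> v (\<lambda>x. k * f x) = k * v f"
    and tv_mult: "\<And>f h. f \<in> C_inf A \<Longrightarrow> h \<in> C_inf A \<Longrightarrow> v (\<lambda>x. f x * h x) = f p * v h + h p * v f"
    and tv_outside: "\<And>f. f \<notin> C_inf A \<Longrightarrow> v f = 0"
  using assms unfolding tangent_space_def by blast+

lemma tangent_spaceI:
  assumes "\<And>f h. f \<in> C_inf A \<Longrightarrow> h \<in> C_inf A \<Longrightarrow> v (\<lambda>x. f x + h x) = v f + v h"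
    and "\<And>k f. f \<in> C_inf A \<Longrightarrow> v (\<lambda>x. k * f x) = k * v f"
    and "\<And>f h. f \<in> C_inf A \<Longrightarrow> h \<in> C_inf A \<Longrightarrow> v (\<lambda>x. f x * h x) = f p * v h + h p * v f"
    and "\<And>f. f \<notin> C_inf A \<Longrightarrow> v f = 0"
  shows "v \<in> tangent_space A p"
  using assms unfolding tangent_space_def by blast

lemma tv_const:
  assumes "v \<in> tangent_space A p"
  shows "v (\<lambda>x. k) = 0"
proof -
  \<comment> \<open>The product rule for 1 * 1 = 1 says that this value is twice itself.\<close>
  have "v (\<lambda>x. 1) = 0"
    using tv_mult[OF assms C_inf_const[of 1] C_inf_const[of 1]] by simp
  then show ?thesis using tv_scale[OF assms C_inf_const[of 1], of k] by simp
qed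

lemma tv_diff:
  assumes "v \<in> tangent_space A p" "f \<in> C_inf A" "h \<in> C_inf A"
  shows "v (\<lambda>x. f x - h x) = v f - v h"
  using tv_add[OF assms(1,2) C_inf_mult[OF C_inf_const[of "-1"] assms(3)]]
    tv_scale[OF assms(1,3), of "-1"] by simp

lemma tv_sum:
  assumes "v \<in> tangent_space A p" "\<And>i. i \<in> I \<Longrightarrow> f i \<in> C_inf A"
  shows "v (\<lambda>x. \<Sum>i\<in>I. f i x) = (\<Sum>i\<in>I. v (f i))"
  using assms(2)
  by (induction I rule: infinite_finite_induct)
    (auto simp: tv_const[OF assms(1)] tv_add[OF assms(1)] C_inf_sum)

lemma subspace_tangent_space: "subspace (tangent_space A p)"
proof (rule subspaceI)
  show "0 \<in> tangent_space A p" by (rule tangent_spaceI) auto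
  fix u v assume uv: "u \<in> tangent_space A p" "v \<in> tangent_space A p"
  show "u + v \<in> tangent_space A p"
    by (rule tangent_spaceI)
      (use uv in \<open>auto simp: tangent_spaceD[OF uv(1)] tangent_spaceD[OF uv(2)] algebra_simps\<close>)
next
  fix k v assume v: "v \<in> tangent_space A p"
  show "k *\<^sub>R v \<in> tangent_space A p"
    by (rule tangent_spaceI) (auto simp: tangent_spaceD[OF v] algebra_simps)
qed

definition coord_deriv :: "'a set \<Rightarrow> ('a \<Rightarrow> 'e) \<Rightarrow> 'a \<Rightarrow> 'e \<Rightarrow> 'a tvec"
  where "coord_deriv U c p e =
    (\<lambda>f. if f \<in> C_inf A then frechet_derivative (f \<circ> inv_into U c) (at (c p)) e else 0)"

lemma has_derivative_chart:
  assumes "(U, c) \<in> A" "p \<in> U" "f \<in> C_inf A"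
  shows "((f \<circ> inv_into U c) has_derivative (\<lambda>e. coord_deriv U c p e f)) (at (c p))"
  using smooth_on_differentiable[OF C_infD[OF assms(3,1)], of "c p"] assms
  by (simp add: coord_deriv_def frechet_derivative_works)

lemma coord_deriv_eqI:
  assumes "(U, c) \<in> A" "p \<in> U" "f \<in> C_inf A" "((f \<circ> inv_into U c) has_derivative L) (at (c p))"
  shows "coord_deriv U c p e f = L e"
  using has_derivative_unique[OF has_derivative_chart[OF assms(1-3)] assms(4)] by metis

lemma coord_deriv_in_tangent_space:
  assumes "(U, c) \<in> A" "p \<in> U"
  shows "coord_deriv U c p e \<in> tangent_space A p"
proof (rule tangent_spaceI)
  fix f h assume fh: "f \<in> C_inf A" "h \<in> C_inf A"
  note D = has_derivative_chart[OF assms fh(1)] has_derivative_chart[OF assms fh(2)]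
  show "coord_deriv U c p e (\<lambda>x. f x + h x) = coord_deriv U c p e f + coord_deriv U c p e h"
    using has_derivative_add[OF D]
    by (intro coord_deriv_eqI[OF assms C_inf_add[OF fh]]) (simp add: o_def)
  have "(((\<lambda>x. f x * h x) \<circ> inv_into U c) has_derivative
      (\<lambda>e. f p * coord_deriv U c p e h + coord_deriv U c p e f * h p)) (at (c p))"
    using has_derivative_mult[OF D] assms by (simp add: o_def)
  from coord_deriv_eqI[OF assms C_inf_mult[OF fh] this]
  show "coord_deriv U c p e (\<lambda>x. f x * h x) = f p * coord_deriv U c p e h + h p * coord_deriv U c p e f"
    by simp
next
  fix k f assume f: "f \<in> C_inf A"
  show "coord_deriv U c p e (\<lambda>x. k * f x) = k * coord_deriv U c p e f"
    using has_derivative_mult_right[OF has_derivative_chart[OF assms f], of k]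
    by (intro coord_deriv_eqI[OF assms C_inf_mult[OF C_inf_const f]]) (simp add: o_def)
qed (simp add: coord_deriv_def)

lemma linear_coord_deriv:
  assumes "(U, c) \<in> A" "p \<in> U"
  shows "linear (coord_deriv U c p)"
proof -
  have l: "linear (\<lambda>e. coord_deriv U c p e f)" if "f \<in> C_inf A" for f
    using has_derivative_chart[OF assms that] has_derivative_linear by blast
  show ?thesis
  proof (rule linearI)
    show "coord_deriv U c p (x + y) = coord_deriv U c p x + coord_deriv U c p y" for x y
    proof
      fix f
      show "coord_deriv U c p (x + y) f = (coord_deriv U c p x + coord_deriv U c p y) f"
        using linear_add[OF l] by (cases "f \<in> C_inf A") (auto simp: coord_deriv_def)
    qed
    show "coord_deriv U c p (k *\<^sub>R x) = k *\<^sub>R coord_deriv U c p x" for k x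
    proof
      fix f
      show "coord_deriv U c p (k *\<^sub>R x) f = (k *\<^sub>R coord_deriv U c p x) f"
        using linear_cmul[OF l] by (cases "f \<in> C_inf A") (auto simp: coord_deriv_def)
    qed
  qed
qed

text \<open>The coordinate functions recover the direction \<open>e\<close>. A bump makes them
  globally smooth without changing their derivative at \<open>p\<close>, since there the bump is 1
  and the centred coordinate is 0.\<close>

lemma inj_coord_deriv:
  assumes Uc: "(U, c) \<in> A" "p \<in> U"
  shows "inj (coord_deriv U c p)"
proof -
  have "e = 0" if 0: "coord_deriv U c p e = 0" for e
  proof (rule euclidean_eqI)
    fix i :: 'e
    obtain b K where b: "b \<in> C_inf A" "closed K" "K \<subseteq> U" "b p = 1" "\<And>q. q \<notin> K \<Longrightarrow> b q = 0"
      using ex_bump[OF Uc(1) chartD(1)[OF Uc(1)] Uc(2) order_refl] by blast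
    let ?G = "\<lambda>q. (c q - c p) \<bullet> i"
    let ?x = "\<lambda>q. if q \<in> U then b q * ?G q else 0"
    have "smooth_on (c ` U) (\<lambda>x. x \<bullet> i + - (c p \<bullet> i))"
      by (intro smooth_on_add smooth_on_const chartD(2)[OF Uc(1)] smooth_on_ident
          smooth_on_bounded_linear[OF bounded_linear_inner_left])
    then have "smooth_on (c ` U) (?G \<circ> inv_into U c)"
      by (rule smooth_on_cong[OF chartD(2)[OF Uc(1)], rotated]) (use Uc in \<open>auto simp: inner_diff_left\<close>)
    from bump_mult_C_inf[OF Uc(1) chartD(1)[OF Uc(1)] order_refl b(2,3,1,5) this]
    have x: "?x \<in> C_inf A" by simp
    have "((\<lambda>x. (b \<circ> inv_into U c) x * ((x - c p) \<bullet> i)) has_derivative (\<lambda>e. e \<bullet> i)) (at (c p))"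
      by (rule has_derivative_eq_rhs[OF has_derivative_mult[OF has_derivative_chart[OF Uc b(1)]]])
        (use b(4) Uc in \<open>auto intro!: derivative_eq_intros\<close>)
    then have "((?x \<circ> inv_into U c) has_derivative (\<lambda>e. e \<bullet> i)) (at (c p))"
      by (rule has_derivative_transform_within_open[OF _ chartD(2)[OF Uc(1)]]) (use Uc in auto)
    from coord_deriv_eqI[OF Uc x this, of e] show "e \<bullet> i = 0 \<bullet> i" using 0 by simp
  qed
  then show ?thesis using linear_injective_0[OF linear_coord_deriv[OF Uc]] by blast
qed

text \<open>By Hadamard's lemma, near \<open>p\<close> a smooth \<open>f\<close> equals \<open>f p + (\<Sum>i. x\<^sub>i h\<^sub>i)\<close> with \<open>x\<^sub>i p = 0\<close>. A bump
  function \<open>b\<close> makes the factors global: \<open>b\<^sup>2 f = f p b\<^sup>2 + (\<Sum>i. (b x\<^sub>i) (b h\<^sub>i))\<close>.\<close>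

lemma tangent_vector_coord:
  assumes Uc: "(U, c) \<in> A" "p \<in> U" and v: "v \<in> tangent_space A p"
  shows "v \<in> range (coord_deriv U c p)"
proof -
  \<comment> \<open>A ball in the chart image is taken because Hadamard's lemma asks for a convex
    domain.\<close>
  obtain r where r: "r > 0" "ball (c p) r \<subseteq> c ` U"
    using chartD(2)[OF Uc(1)] Uc by (meson imageI open_contains_ball)
  let ?S = "ball (c p) r"
  define W where "W = inv_into U c ` ?S"
  have W: "open W" unfolding W_def by (rule open_chart_inv_image[OF Uc(1) open_ball r(2)])
  have WU: "W \<subseteq> U" unfolding W_def using r(2) by (auto intro: inv_into_into)
  have cW: "c ` W = ?S" unfolding W_def using r(2) by (rule image_inv_into_cancel[OF refl])
  have pW: "p \<in> W" unfolding W_def using r(1) Uc by (intro image_eqI[of _ _ "c p"]) auto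
  have oS: "open (c ` W)" by (simp add: cW)
  obtain b K where b: "b \<in> C_inf A" "closed K" "K \<subseteq> W" "b p = 1" "\<And>q. q \<notin> K \<Longrightarrow> b q = 0"
    using ex_bump[OF Uc(1) W pW WU] by blast
  have bump: "(\<lambda>q. if q \<in> W then b q * G q else 0) \<in> C_inf A"
    if "smooth_on (c ` W) (G \<circ> inv_into U c)" for G
    by (rule bump_mult_C_inf[OF Uc(1) W WU b(2,3,1) _ that]) (rule b(5))
  define x where "x = (\<lambda>i q. if q \<in> W then b q * ((c q - c p) \<bullet> i) else 0)"
  have x: "x i \<in> C_inf A" for i
  proof -
    have "smooth_on (c ` W) (\<lambda>y. y \<bullet> i + - (c p \<bullet> i))"
      by (intro smooth_on_add smooth_on_const oS smooth_on_ident
          smooth_on_bounded_linear[OF bounded_linear_inner_left])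
    then have "smooth_on (c ` W) ((\<lambda>q. (c q - c p) \<bullet> i) \<circ> inv_into U c)"
      by (rule smooth_on_cong[OF oS, rotated]) (use Uc WU in \<open>auto simp: inner_diff_left subset_iff\<close>)
    from bump[OF this] show ?thesis by (simp add: x_def)
  qed
  have x0: "x i p = 0" for i by (simp add: x_def)
  let ?e = "\<Sum>i\<in>Basis. v (x i) *\<^sub>R i"
  have "v f = coord_deriv U c p ?e f" for f
  proof (cases "f \<in> C_inf A")
    case f: True
    have "smooth_on ?S (f \<circ> inv_into U c)"
      by (rule smooth_on_subset[OF C_infD[OF f Uc(1)] r(2)])
    from Hadamard[OF open_ball convex_ball centre_in_ball[THEN iffD2, OF r(1)] this]
    obtain h where h: "\<And>i. smooth_on ?S (h i)"
      "\<And>i. h i (c p) = frechet_derivative (f \<circ> inv_into U c) (at (c p)) i"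
      "\<And>y. y \<in> ?S \<Longrightarrow> (f \<circ> inv_into U c) y =
         (f \<circ> inv_into U c) (c p) + (\<Sum>i\<in>Basis. ((y - c p) \<bullet> i) * h i y)"
      by blast
    define H where "H = (\<lambda>i q. if q \<in> W then b q * h i (c q) else 0)"
    have H: "H i \<in> C_inf A" for i
    proof -
      have "smooth_on (c ` W) ((\<lambda>q. h i (c q)) \<circ> inv_into U c)"
        by (rule smooth_on_cong[OF oS _ h(1)[of i, folded cW]]) (use Uc WU in \<open>auto simp: subset_iff\<close>)
      from bump[OF this] show ?thesis by (simp add: H_def)
    qed
    have eq: "(\<lambda>q. (b q * b q) * f q) = (\<lambda>q. f p * (b q * b q) + (\<Sum>i\<in>Basis. x i q * H i q))"
    proof
      fix q
      show "(b q * b q) * f q = f p * (b q * b q) + (\<Sum>i\<in>Basis. x i q * H i q)"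
      proof (cases "q \<in> W")
        case True
        then have "c q \<in> ?S" "q \<in> U" using cW WU by auto
        from h(3)[OF this(1)] this(2) have fq: "f q = f p + (\<Sum>i\<in>Basis. ((c q - c p) \<bullet> i) * h i (c q))"
          using Uc by simp
        have "(b q * b q) * f q = f p * (b q * b q) +
            (\<Sum>i\<in>Basis. (b q * b q) * (((c q - c p) \<bullet> i) * h i (c q)))"
          by (subst fq) (simp only: distrib_left sum_distrib_left mult.commute[of "f p"])
        also have "(\<Sum>i\<in>Basis. (b q * b q) * (((c q - c p) \<bullet> i) * h i (c q))) = (\<Sum>i\<in>Basis. x i q * H i q)"
          by (rule sum.cong) (use True in \<open>auto simp: x_def H_def\<close>)
        finally show ?thesis .
      next
        case False
        then show ?thesis using b by (auto simp: x_def H_def)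
      qed
    qed
    have bb: "(\<lambda>q. b q * b q) \<in> C_inf A" by (rule C_inf_mult[OF b(1) b(1)])
    \<comment> \<open>When \<open>v\<close> is applied to both sides of \<open>eq\<close>, the terms
      with \<open>v\<close> of \<open>b * b\<close> cancel and \<open>x i p = 0\<close> removes half
      of each product rule. What remains is the sum of \<open>H i p * v (x i)\<close>, where
      \<open>H i p\<close> is a partial derivative of \<open>f\<close>.\<close>
    have "v (\<lambda>q. (b q * b q) * f q) = v f + f p * v (\<lambda>q. b q * b q)"
      using tv_mult[OF v bb f] b(4) by simp
    moreover have "v (\<lambda>q. f p * (b q * b q) + (\<Sum>i\<in>Basis. x i q * H i q)) =
        f p * v (\<lambda>q. b q * b q) + (\<Sum>i\<in>Basis. H i p * v (x i))"
      using x H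
      by (simp add: tv_add[OF v] tv_scale[OF v bb] tv_sum[OF v] tv_mult[OF v] C_inf_mult C_inf_sum
          C_inf_const bb x0)
    ultimately have "v f = (\<Sum>i\<in>Basis. v (x i) * coord_deriv U c p i f)"
      using eq pW b(4) f by (simp add: H_def h(2) coord_deriv_def mult.commute)
    also have "\<dots> = coord_deriv U c p ?e f"
      by (simp add: linear_sum[OF has_derivative_linear[OF has_derivative_chart[OF Uc f]]]
          linear_cmul[OF has_derivative_linear[OF has_derivative_chart[OF Uc f]]])
    finally show ?thesis .
  next
    case False
    then show ?thesis using tv_outside[OF v] by (simp add: coord_deriv_def)
  qed
  then show ?thesis by blast
qed

text \<open>This carries the dimension of the model space to the tangent space; the traces and the
  existence of nonzero horizontal vectors depend on it.\<close>

lemma tangent_space_iso: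
  obtains T :: "'e \<Rightarrow> 'a tvec" where "linear T" "inj T" "range T = tangent_space A p"
proof -
  obtain U c where Uc: "(U, c) \<in> A" "p \<in> U" by (rule ex_chart)
  have "range (coord_deriv U c p) = tangent_space A p"
    using tangent_vector_coord[OF Uc] coord_deriv_in_tangent_space[OF Uc] by blast
  then show ?thesis using that linear_coord_deriv[OF Uc] inj_coord_deriv[OF Uc] by blast
qed

section \<open>Extension of tangent vectors, module structure and bracket of vector fields\<close>

lemma vector_fieldD:
  assumes "vector_field A X"
  shows "X p \<in> tangent_space A p" "f \<in> C_inf A \<Longrightarrow> (\<lambda>p. X p f) \<in> C_inf A"
  using assms unfolding vector_field_def by blast+

text \<open>The extension has constant coefficients in a chart, cut off by a bump with value 1 at
  \<open>p\<close>. Pointwise identities can then be tested with vector fields, and the choice in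
  \<open>induced_endo\<close> is a genuine extension.\<close>

lemma ex_vector_field:
  assumes v: "v \<in> tangent_space A p"
  obtains X where "vector_field A X" "X p = v"
proof -
  obtain U c where Uc: "(U, c) \<in> A" "p \<in> U" by (rule ex_chart)
  obtain e where e: "v = coord_deriv U c p e" using tangent_vector_coord[OF Uc v] by blast
  obtain b K where b: "b \<in> C_inf A" "closed K" "K \<subseteq> U" "b p = 1" "\<And>q. q \<notin> K \<Longrightarrow> b q = 0"
    using ex_bump[OF Uc(1) chartD(1)[OF Uc(1)] Uc(2) order_refl] by blast
  define X where "X = (\<lambda>q. if q \<in> U then b q *\<^sub>R coord_deriv U c q e else 0)"
  have "X q \<in> tangent_space A q" for q
    using coord_deriv_in_tangent_space[OF Uc(1)]
    by (auto simp: X_def intro: subspace_scale[OF subspace_tangent_space]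
        subspace_0[OF subspace_tangent_space])
  moreover have "(\<lambda>q. X q f) \<in> C_inf A" if f: "f \<in> C_inf A" for f
  proof -
    have "smooth_on (c ` U) ((\<lambda>q. coord_deriv U c q e f) \<circ> inv_into U c)"
      by (rule smooth_on_cong[OF chartD(2)[OF Uc(1)] _
            smooth_on_frechet_derivative[OF C_infD[OF f Uc(1)], of e]])
        (use f Uc in \<open>auto simp: coord_deriv_def\<close>)
    from bump_mult_C_inf[OF Uc(1) chartD(1)[OF Uc(1)] order_refl b(2,3,1,5) this]
    show ?thesis by (simp add: X_def if_distrib[of "\<lambda>v. v f"] cong: if_cong)
  qed
  ultimately have "vector_field A X" unfolding vector_field_def by blast
  moreover have "X p = v" using Uc b(4) e by (simp add: X_def)
  ultimately show ?thesis using that by blast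
qed

lemma vector_field_add: "vector_field A X \<Longrightarrow> vector_field A Y \<Longrightarrow> vector_field A (X + Y)"
  unfolding vector_field_def
  using subspace_add[OF subspace_tangent_space] C_inf_add by auto

lemma vector_field_fscale:
  "f \<in> C_inf A \<Longrightarrow> vector_field A X \<Longrightarrow> vector_field A (f \<odot> X)"
  unfolding vector_field_def fscale_def
  using subspace_scale[OF subspace_tangent_space] C_inf_mult by auto

lemma vector_field_diff:
  assumes "vector_field A X" "vector_field A Y"
  shows "vector_field A (X - Y)"
proof -
  have e: "X - Y = X + (\<lambda>p. - 1) \<odot> Y" by (simp add: fscale_def fun_eq_iff)
  show ?thesis unfolding e
    by (intro vector_field_add vector_field_fscale C_inf_const assms)
qed

text \<open>Each composition of \<open>X\<close> and \<open>Y\<close> alone violates the product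
  rule by cross terms that are symmetric in \<open>X\<close> and \<open>Y\<close>; they cancel in
  the difference.\<close>

lemma vector_field_lie_bracket:
  assumes X: "vector_field A X" and Y: "vector_field A Y"
  shows "vector_field A (lie_bracket X Y)"
proof -
  have "lie_bracket X Y p \<in> tangent_space A p" for p
  proof (rule tangent_spaceI)
    note tX = vector_fieldD(1)[OF X] and tY = vector_fieldD(1)[OF Y]
    fix f h assume fh: "f \<in> C_inf A" "h \<in> C_inf A"
    note s = fh vector_fieldD(2)[OF X fh(1)] vector_fieldD(2)[OF X fh(2)]
      vector_fieldD(2)[OF Y fh(1)] vector_fieldD(2)[OF Y fh(2)]
    show "lie_bracket X Y p (\<lambda>x. f x + h x) = lie_bracket X Y p f + lie_bracket X Y p h"
      by (simp add: lie_bracket_def tv_add[OF tX] tv_add[OF tY] s)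
    show "lie_bracket X Y p (\<lambda>x. f x * h x) = f p * lie_bracket X Y p h + h p * lie_bracket X Y p f"
      by (simp add: lie_bracket_def tv_add[OF tX] tv_add[OF tY] tv_mult[OF tX] tv_mult[OF tY]
          s C_inf_mult algebra_simps)
  next
    note tX = vector_fieldD(1)[OF X] and tY = vector_fieldD(1)[OF Y]
    fix k f assume f: "f \<in> C_inf A"
    note s = f vector_fieldD(2)[OF X f] vector_fieldD(2)[OF Y f]
    show "lie_bracket X Y p (\<lambda>x. k * f x) = k * lie_bracket X Y p f"
      by (simp add: lie_bracket_def tv_scale[OF tX] tv_scale[OF tY] s algebra_simps)
  next
    note tX = vector_fieldD(1)[OF X] and tY = vector_fieldD(1)[OF Y]
    \<comment> \<open>Here \<open>X q f\<close> and \<open>Y q f\<close> are 0 for all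
      \<open>q\<close>, so the outer vectors are applied to a constant function.\<close>
    fix f assume "f \<notin> C_inf A"
    then show "lie_bracket X Y p f = 0"
      by (simp add: lie_bracket_def tv_outside[OF tX] tv_outside[OF tY] tv_const[OF tX] tv_const[OF tY])
  qed
  moreover have "(\<lambda>p. lie_bracket X Y p f) \<in> C_inf A" if "f \<in> C_inf A" for f
    unfolding lie_bracket_def
    by (rule C_inf_diff[OF vector_fieldD(2)[OF X vector_fieldD(2)[OF Y that]]
        vector_fieldD(2)[OF Y vector_fieldD(2)[OF X that]]])
  ultimately show ?thesis unfolding vector_field_def by blast
qed

end

section \<open>Traces\<close>

lemma linear_on_subspaceD:
  assumes "linear_on_subspace V L"
  shows "u \<in> V \<Longrightarrow> v \<in> V \<Longrightarrow> L (u + v) = L u + L v"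
    and "u \<in> V \<Longrightarrow> L (k *\<^sub>R u) = k *\<^sub>R L u"
  using assms unfolding linear_on_subspace_def by blast+

lemma linear_on_subspace_sum:
  assumes "linear_on_subspace V L" "subspace V" "\<And>i. i \<in> I \<Longrightarrow> x i \<in> V"
  shows "L (\<Sum>i\<in>I. k i *\<^sub>R x i) = (\<Sum>i\<in>I. k i *\<^sub>R L (x i))"
proof -
  have "L 0 = 0"
    using linear_on_subspaceD(2)[OF assms(1) subspace_0[OF assms(2)], of 0] by simp
  with assms(3) show ?thesis
    by (induction I rule: infinite_finite_induct)
      (auto simp: linear_on_subspaceD[OF assms(1)] subspace_scale[OF assms(2)] subspace_sum[OF assms(2)])
qed

text \<open>A tangent space lies in a function type that is no \<open>euclidean_space\<close>; its
  finite dimension is imported through the isomorphism \<open>T\<close>.\<close>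

locale coordinatized_subspace =
  fixes V :: "'v::real_vector set" and T :: "'e::euclidean_space \<Rightarrow> 'v"
  assumes lin: "linear T" and inj: "inj T" and range: "range T = V"
begin

lemma subspace_V: "subspace V"
  using linear_subspace_image[OF lin subspace_UNIV] range by simp

text \<open>The same choice term as in \<open>trace_on\<close>, named so that the trace becomes a
  sum over one fixed basis.\<close>

definition base :: "'v set"
  where "base = (SOME B. independent B \<and> span B = V)"

lemma base: "independent base" "span base = V"
proof -
  obtain B where "B \<subseteq> V" "independent B" "V \<subseteq> span B" by (rule basis_exists)
  then have "\<exists>B. independent B \<and> span B = V"
    using span_minimal[OF _ subspace_V] by blast
  then have "independent base \<and> span base = V" unfolding base_def by (rule someI_ex)
  then show "independent base" "span base = V" by blast+
qed

lemma trace_on_base: "trace_on V L = (\<Sum>b\<in>base. representation base (L b) b)"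
  unfolding trace_on_def base_def by (simp add: Let_def)

lemma base_in: "b \<in> base \<Longrightarrow> b \<in> V"
  using base(2) span_superset by blast

lemma finite_base: "finite base" and card_base: "card base = DIM('e)"
proof -
  \<comment> \<open>A left inverse of \<open>T\<close> is injective on \<open>V\<close> and maps
    \<open>base\<close> onto a basis of the model space, whose size is known.\<close>
  obtain G where G: "linear G" "G \<circ> T = id"
    using linear_injective_left_inverse[OF lin inj] by blast
  have GT: "G (T x) = x" for x using G(2) by (metis comp_apply id_apply)
  have injG: "inj_on G V"
    unfolding range[symmetric] by (rule inj_onI) (auto simp: GT)
  have ind: "independent (G ` base)"
    by (rule linear_independent_injective_image[OF G(1) base(1)]) (simp add: base(2) injG)
  have "span (G ` base) = G ` V"
    using linear_span_image[OF G(1)] base(2) by simp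
  also have "\<dots> = UNIV" unfolding range[symmetric] by (auto simp: GT image_iff intro: rangeI)
  finally have "span (G ` base) = UNIV" .
  then have card: "card (G ` base) = DIM('e)" "finite (G ` base)"
    using basis_card_eq_dim[of "G ` base" UNIV] ind independent_imp_finite by auto
  have i: "inj_on G base" by (rule inj_on_subset[OF injG]) (use base_in in blast)
  show "finite base" using card(2) i finite_imageD by blast
  show "card base = DIM('e)" using card(1) card_image[OF i] by simp
qed

lemma base_expansion: "v \<in> V \<Longrightarrow> (\<Sum>b\<in>base. representation base v b *\<^sub>R b) = v"
  by (rule sum_representation_eq[OF base(1)]) (auto simp: base finite_base)

lemma trace_on_cong: "(\<And>v. v \<in> V \<Longrightarrow> L v = M v) \<Longrightarrow> trace_on V L = trace_on V M"
  by (simp add: trace_on_base base_in)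

lemma trace_on_add:
  assumes "L ` V \<subseteq> V" "M ` V \<subseteq> V"
  shows "trace_on V (\<lambda>v. L v + M v) = trace_on V L + trace_on V M"
proof -
  have "representation base (L b + M b) b = representation base (L b) b + representation base (M b) b"
    if "b \<in> base" for b
    by (subst representation_add[OF base(1)]) (use assms base_in that base(2) in auto)
  then show ?thesis by (simp add: trace_on_base sum.distrib)
qed

lemma trace_on_scale:
  assumes "L ` V \<subseteq> V"
  shows "trace_on V (\<lambda>v. k *\<^sub>R L v) = k * trace_on V L"
proof -
  have "representation base (k *\<^sub>R L b) b = k * representation base (L b) b"
    if "b \<in> base" for b
    by (subst representation_scale[OF base(1)]) (use assms base_in that base(2) in auto)
  then show ?thesis by (simp add: trace_on_base sum_distrib_left)
qed

lemma trace_on_id: "trace_on V (\<lambda>v. v) = DIM('e)"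
  by (simp add: trace_on_base representation_basis[OF base(1)] card_base)

text \<open>The diagonal entry at \<open>b\<close> is \<open>f b\<close> times the
  \<open>b\<close>-coordinate of \<open>y\<close>, so the sum is \<open>f\<close> applied to the
  expansion of \<open>y\<close>.\<close>

lemma trace_on_rank1:
  assumes "linear_on_subspace V f" "y \<in> V"
  shows "trace_on V (\<lambda>v. f v *\<^sub>R y) = f y"
proof -
  have "trace_on V (\<lambda>v. f v *\<^sub>R y) = (\<Sum>b\<in>base. representation base y b *\<^sub>R f b)"
    unfolding trace_on_base
    by (rule sum.cong[OF refl], subst representation_scale[OF base(1)]) (use assms(2) base(2) in auto)
  also have "\<dots> = f (\<Sum>b\<in>base. representation base y b *\<^sub>R b)"
    by (rule linear_on_subspace_sum[OF assms(1) subspace_V, symmetric]) (rule base_in)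
  finally show ?thesis by (simp add: base_expansion[OF assms(2)])
qed

text \<open>\<open>?M x\<close> collects the values of the functional represented by
  \<open>T x\<close> on the images of the standard basis. Positivity makes this linear map
  injective, hence surjective on the model space, so the values of \<open>f\<close> are
  attained.\<close>

lemma riesz:
  fixes g :: "'v \<Rightarrow> 'v \<Rightarrow> real"
  assumes lin_g: "\<And>u. u \<in> V \<Longrightarrow> linear_on_subspace V (g u)"
    and sym: "\<And>u v. u \<in> V \<Longrightarrow> v \<in> V \<Longrightarrow> g u v = g v u"
    and pos: "\<And>u. u \<in> V \<Longrightarrow> u \<noteq> 0 \<Longrightarrow> g u u > 0"
    and f: "linear_on_subspace V f"
  obtains w where "w \<in> V" "\<And>v. v \<in> V \<Longrightarrow> g w v = f v"
proof -
  have TV: "T x \<in> V" for x using range by blast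
  have l: "linear (\<lambda>y. h (T y))" if "linear_on_subspace V h" for h :: "'v \<Rightarrow> real"
    by (rule linearI)
      (auto simp: linear_add[OF lin] linear_cmul[OF lin] linear_on_subspaceD[OF that] TV)
  have l2: "linear (\<lambda>x. g (T x) (T y))" for y
    using l[OF lin_g[OF TV[of y]]] sym[OF TV TV] by (simp add: sym[OF TV TV, of y])
  let ?M = "\<lambda>x. \<Sum>b\<in>Basis. g (T x) (T b) *\<^sub>R b"
  have linM: "linear ?M"
    by (rule linearI)
      (auto simp: linear_add[OF l2] linear_cmul[OF l2] scaleR_left_distrib sum.distrib scaleR_sum_right)
  have "x = 0" if M0: "?M x = 0" for x
  proof -
    have "g (T x) (T b) = 0" if "b \<in> Basis" for b
      using arg_cong[OF M0, of "\<lambda>v. v \<bullet> b"] that by (simp add: inner_sum_left_Basis)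
    then have "(\<lambda>y. g (T x) (T y)) = (\<lambda>y. 0)"
      by (intro linear_eq_stdbasis l lin_g TV linear_zero) auto
    then have "g (T x) (T x) = 0" by (rule fun_cong)
    then have "T x = 0" using pos[OF TV] by force
    then show ?thesis using linear_injective_0[OF lin] inj by blast
  qed
  then have "inj ?M" using linear_injective_0[OF linM] by blast
  then have "surj ?M" using linear_injective_imp_surjective[OF linM] by blast
  from surjD[OF this, of "\<Sum>b\<in>Basis. f (T b) *\<^sub>R b"]
  obtain x where x: "(\<Sum>b\<in>Basis. f (T b) *\<^sub>R b) = ?M x" by blast
  have "g (T x) (T b) = f (T b)" if "b \<in> Basis" for b
    using arg_cong[OF x[symmetric], of "\<lambda>v. v \<bullet> b"] that by (simp add: inner_sum_left_Basis)
  then have eq: "(\<lambda>y. g (T x) (T y)) = (\<lambda>y. f (T y))"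
    by (intro linear_eq_stdbasis l lin_g TV f) auto
  have "g (T x) v = f v" if v: "v \<in> V" for v
  proof -
    obtain y where "v = T y" using v range by blast
    then show ?thesis using fun_cong[OF eq, of y] by simp
  qed
  then show ?thesis using that TV by blast
qed

text \<open>With \<open>w b\<close> the \<open>g\<close>-dual basis, the trace is a contraction of the symmetric Gram matrix of \<open>w\<close>
  with the skew-symmetric matrix \<open>g (L c) b\<close>.\<close>

lemma trace_on_skew:
  fixes g :: "'v \<Rightarrow> 'v \<Rightarrow> real"
  assumes lin_g: "\<And>u. u \<in> V \<Longrightarrow> linear_on_subspace V (g u)"
    and sym: "\<And>u v. u \<in> V \<Longrightarrow> v \<in> V \<Longrightarrow> g u v = g v u"
    and pos: "\<And>u. u \<in> V \<Longrightarrow> u \<noteq> 0 \<Longrightarrow> g u u > 0"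
    and L: "linear_on_subspace V L" "L ` V \<subseteq> V"
    and skew: "\<And>u v. u \<in> V \<Longrightarrow> v \<in> V \<Longrightarrow> g (L u) v = - g u (L v)"
  shows "trace_on V L = 0"
proof -
  let ?r = "representation base"
  have LV: "L u \<in> V" if "u \<in> V" for u using L(2) that by blast
  have "\<exists>w\<in>V. \<forall>v\<in>V. g w v = ?r v b" for b
  proof -
    have "linear_on_subspace V (\<lambda>v. ?r v b)"
      by (simp add: linear_on_subspace_def representation_add[OF base(1)]
          representation_scale[OF base(1)] base(2))
    from riesz[OF lin_g sym pos this] show ?thesis by metis
  qed
  then obtain w where wV: "\<And>b. w b \<in> V" and w: "\<And>b v. v \<in> V \<Longrightarrow> g (w b) v = ?r v b"
    by metis
  define H where "H = (\<lambda>b c. g (w b) (w c))"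
  define S where "S = (\<lambda>b c. g (L b) c)"
  have Hsym: "H b c = H c b" for b c unfolding H_def by (rule sym[OF wV wV])
  have Sskew: "S c b = - S b c" if "b \<in> base" "c \<in> base" for b c
    using skew[OF base_in base_in, OF that] sym[OF LV base_in, OF base_in that(1), OF that(2)]
    by (simp add: S_def sym LV base_in that)
  have "?r (L b) b = - (\<Sum>c\<in>base. H c b * S c b)" if b: "b \<in> base" for b
  proof -
    \<comment> \<open>Skewness moves \<open>L\<close> onto the dual vector \<open>w b\<close>, whose
      coordinate at \<open>c\<close> is \<open>g (w c) (w b)\<close>, the Gram entry
      \<open>H c b\<close>.\<close>
    have "?r (L b) b = g (w b) (L b)" using w[OF LV[OF base_in[OF b]]] by simp
    also have "\<dots> = - g (L (w b)) b" using skew[OF wV base_in[OF b]] by simp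
    also have "L (w b) = L (\<Sum>c\<in>base. ?r (w b) c *\<^sub>R c)" by (simp add: base_expansion[OF wV])
    also have "\<dots> = (\<Sum>c\<in>base. ?r (w b) c *\<^sub>R L c)"
      by (rule linear_on_subspace_sum[OF L(1) subspace_V]) (rule base_in)
    also have "g \<dots> b = g b \<dots>"
      by (rule sym[OF subspace_sum[OF subspace_V] base_in[OF b]])
        (rule subspace_scale[OF subspace_V LV[OF base_in]])
    also have "\<dots> = (\<Sum>c\<in>base. ?r (w b) c *\<^sub>R g b (L c))"
      by (rule linear_on_subspace_sum[OF lin_g[OF base_in[OF b]] subspace_V])
        (rule LV[OF base_in])
    also have "\<dots> = (\<Sum>c\<in>base. H c b * S c b)"
      by (rule sum.cong[OF refl]) (simp add: H_def S_def w[OF wV] sym[OF base_in[OF b] LV[OF base_in]])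
    finally show ?thesis .
  qed
  then have tr: "trace_on V L = - (\<Sum>b\<in>base. \<Sum>c\<in>base. H c b * S c b)"
    by (simp add: trace_on_base sum_negf)
  \<comment> \<open>Exchanging the names of the indices turns the sum into its negative, by
    \<open>Hsym\<close> and \<open>Sskew\<close>.\<close>
  have "(\<Sum>b\<in>base. \<Sum>c\<in>base. H c b * S c b) = (\<Sum>c\<in>base. \<Sum>b\<in>base. H c b * S c b)"
    by (rule sum.swap)
  also have "\<dots> = (\<Sum>c\<in>base. \<Sum>b\<in>base. - (H b c * S b c))"
    by (intro sum.cong refl) (metis Hsym Sskew mult_minus_right)
  finally have "(\<Sum>b\<in>base. \<Sum>c\<in>base. H c b * S c b) = 0" by (simp add: sum_negf)
  then show ?thesis using tr by simp
qed

end

section \<open>Curvature of the generalized symmetric metric connection\<close>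

locale kenmotsu_gsm =
  fixes A :: "('a::{t2_space, second_countable_topology}, 'e::euclidean_space) atlas"
    and \<phi> :: "'a \<Rightarrow> 'a tvec \<Rightarrow> 'a tvec"
    and \<xi> :: "'a vfield"
    and \<eta> :: "'a \<Rightarrow> 'a tvec \<Rightarrow> real"
    and g :: "'a \<Rightarrow> 'a tvec \<Rightarrow> 'a tvec \<Rightarrow> real"
    and N D :: "'a conn"
    and \<alpha> \<beta> :: "'a \<Rightarrow> real"
  assumes ken: "kenmotsu A \<phi> \<xi> \<eta> g N"
    and alpha: "\<alpha> \<in> C_inf A"
    and gsm: "gen_symmetric_metric_connection A \<phi> \<eta> g \<alpha> \<beta> D"
begin

section \<open>Pointwise algebra of the almost contact metric structure\<close>

lemma acm: "almost_contact_metric A \<phi> \<xi> \<eta> g" and lc: "levi_civita A g N"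
  and N_xi: "\<And>X. vector_field A X \<Longrightarrow> N X \<xi> = X - app_form \<eta> X \<odot> \<xi>"
  using ken unfolding kenmotsu_def by blast+

sublocale smooth_manifold A
  using acm unfolding almost_contact_metric_def by unfold_locales blast

lemma
  shows phi_field: "endo_field A \<phi>" and vf_xi: "vector_field A \<xi>" and eta_form: "one_form A \<eta>"
    and g_metric: "riemannian_metric A g"
    and phi_xi [simp]: "\<phi> p (\<xi> p) = 0" and eta_xi [simp]: "\<eta> p (\<xi> p) = 1"
  using acm unfolding almost_contact_metric_def by blast+

lemma
  assumes "u \<in> tangent_space A p"
  shows eta_phi [simp]: "\<eta> p (\<phi> p u) = 0"
    and phi_phi: "\<phi> p (\<phi> p u) = - u + \<eta> p u *\<^sub>R \<xi> p"
    and g_xi [simp]: "g p u (\<xi> p) = \<eta> p u"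
    and g_phi_phi: "v \<in> tangent_space A p \<Longrightarrow> g p (\<phi> p u) (\<phi> p v) = g p u v - \<eta> p u * \<eta> p v"
  using acm assms unfolding almost_contact_metric_def by blast+

lemma g_linear: "u \<in> tangent_space A p \<Longrightarrow> linear_on_subspace (tangent_space A p) (g p u)"
  and g_sym: "u \<in> tangent_space A p \<Longrightarrow> v \<in> tangent_space A p \<Longrightarrow> g p u v = g p v u"
  and g_pos: "u \<in> tangent_space A p \<Longrightarrow> u \<noteq> 0 \<Longrightarrow> g p u u > 0"
  and C_inf_metric: "vector_field A X \<Longrightarrow> vector_field A Y \<Longrightarrow> app_metric g X Y \<in> C_inf A"
  using g_metric unfolding riemannian_metric_def by blast+

lemma eta_linear: "linear_on_subspace (tangent_space A p) (\<eta> p)"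
  and C_inf_form: "vector_field A X \<Longrightarrow> app_form \<eta> X \<in> C_inf A"
  using eta_form unfolding one_form_def by blast+

lemma phi_linear: "linear_on_subspace (tangent_space A p) (\<phi> p)"
  and phi_image: "\<phi> p ` tangent_space A p \<subseteq> tangent_space A p"
  using phi_field unfolding endo_field_def by blast+

lemma tangent_closed [simp, intro]:
  "0 \<in> tangent_space A p"
  "\<xi> p \<in> tangent_space A p"
  "u \<in> tangent_space A p \<Longrightarrow> v \<in> tangent_space A p \<Longrightarrow> u + v \<in> tangent_space A p"
  "u \<in> tangent_space A p \<Longrightarrow> v \<in> tangent_space A p \<Longrightarrow> u - v \<in> tangent_space A p"
  "u \<in> tangent_space A p \<Longrightarrow> - u \<in> tangent_space A p"
  "u \<in> tangent_space A p \<Longrightarrow> k *\<^sub>R u \<in> tangent_space A p"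
  "u \<in> tangent_space A p \<Longrightarrow> \<phi> p u \<in> tangent_space A p"
  using subspace_tangent_space[of p] vector_fieldD(1)[OF vf_xi] phi_image
  by (auto simp: image_subset_iff intro: subspace_0 subspace_add subspace_diff subspace_neg subspace_scale)

lemma linear_on_tangent_scale:
  assumes "linear_on_subspace (tangent_space A p) L" "u \<in> tangent_space A p"
  shows "L (k *\<^sub>R u) = k *\<^sub>R L u" "L (- u) = - L u"
proof -
  show s: "L (k *\<^sub>R u) = k *\<^sub>R L u" for k
    using linear_on_subspaceD(2)[OF assms] .
  show "L (- u) = - L u" using s[of "-1"] by simp
qed

lemma linear_on_tangent_add:
  assumes "linear_on_subspace (tangent_space A p) L"
    and "u \<in> tangent_space A p" "v \<in> tangent_space A p"
  shows "L (u + v) = L u + L v" "L (u - v) = L u - L v"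
proof -
  show "L (u + v) = L u + L v" using linear_on_subspaceD(1)[OF assms] .
  show "L (u - v) = L u - L v"
    using linear_on_subspaceD(1)[OF assms(1,2), of "- v"] linear_on_tangent_scale(2)[OF assms(1,3)]
      assms(3) by auto
qed

lemma linear_on_tangent_0:
  assumes "linear_on_subspace (tangent_space A p) L"
  shows "L 0 = 0"
  using linear_on_subspaceD(2)[OF assms tangent_closed(1), of 0] by simp

lemmas eta_simps [simp] = linear_on_tangent_add[OF eta_linear] linear_on_tangent_scale[OF eta_linear]
  linear_on_tangent_0[OF eta_linear]
lemmas phi_simps [simp] = linear_on_tangent_add[OF phi_linear] linear_on_tangent_scale[OF phi_linear]
  linear_on_tangent_0[OF phi_linear]
lemmas g_simps_right [simp] = linear_on_tangent_add[OF g_linear] linear_on_tangent_scale[OF g_linear]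
  linear_on_tangent_0[OF g_linear]

lemma g_add_left [simp]:
  assumes "u \<in> tangent_space A p" "v \<in> tangent_space A p" "w \<in> tangent_space A p"
  shows "g p (u + v) w = g p u w + g p v w" "g p (u - v) w = g p u w - g p v w"
  using assms by (simp_all add: g_sym[of _ p w])

lemma g_scale_left [simp]:
  assumes "u \<in> tangent_space A p" "w \<in> tangent_space A p"
  shows "g p (k *\<^sub>R u) w = k * g p u w" "g p (- u) w = - g p u w"
  using assms by (simp_all add: g_sym[of _ p w])

lemma g_zero_left [simp]: "u \<in> tangent_space A p \<Longrightarrow> g p 0 u = 0"
  using g_sym[of 0 p u] by simp

lemma g_xi_left [simp]: "u \<in> tangent_space A p \<Longrightarrow> g p (\<xi> p) u = \<eta> p u"
  using g_sym[of "\<xi> p" p u] by simp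

text \<open>Replace \<open>v\<close> by its image under \<phi> in the compatibility of \<phi> with
  the metric; the terms with \<eta> vanish because \<eta> is 0 on that image.\<close>

lemma phi_skew:
  assumes "u \<in> tangent_space A p" "v \<in> tangent_space A p"
  shows "g p (\<phi> p u) v = - g p u (\<phi> p v)"
  using g_phi_phi[OF assms(1), of "\<phi> p v"] assms by (simp add: phi_phi)

lemma metric_eqI:
  assumes "u \<in> tangent_space A p" "v \<in> tangent_space A p"
    and "\<And>w. w \<in> tangent_space A p \<Longrightarrow> g p u w = g p v w"
  shows "u = v"
proof (rule ccontr)
  assume "u \<noteq> v"
  then have "g p (u - v) (u - v) > 0" using assms by (intro g_pos) auto
  moreover have "g p (u - v) (u - v) = 0" using assms by simp
  ultimately show False by simp
qed

section \<open>The two metric connections and the derivatives of \<xi>\<close>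

lemma linear_connectionD:
  assumes "linear_connection A C"
  shows "vector_field A X \<Longrightarrow> vector_field A Y \<Longrightarrow> vector_field A (C X Y)"
    and "vector_field A X \<Longrightarrow> vector_field A Y \<Longrightarrow> vector_field A Z \<Longrightarrow> C Z (X + Y) = C Z X + C Z Y"
    and "f \<in> C_inf A \<Longrightarrow> vector_field A X \<Longrightarrow> vector_field A Y \<Longrightarrow>
      C X (f \<odot> Y) = (\<lambda>p. X p f) \<odot> Y + f \<odot> C X Y"
  using assms unfolding linear_connection_def by blast+

lemma app_metric_apply: "app_metric g X Y p = g p (X p) (Y p)"
  by (simp add: app_metric_def)

lemma parallel_metricD:
  assumes "parallel_metric A g C" "vector_field A X" "vector_field A Y" "vector_field A Z"
  shows "X p (app_metric g Y Z) = g p (C X Y p) (Z p) + g p (Y p) (C X Z p)"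
proof -
  have "X p (app_metric g Y Z) - app_metric g (C X Y) Z p - app_metric g Y (C X Z) p = 0"
    using assms unfolding parallel_metric_def by blast
  then show ?thesis by (simp add: app_metric_apply)
qed

lemma D_conn: "linear_connection A D" and D_metric: "parallel_metric A g D"
  using gsm unfolding gen_symmetric_metric_connection_def by blast+

lemma N_conn: "linear_connection A N" and N_metric: "parallel_metric A g N"
  using lc unfolding levi_civita_def by blast+

lemma D_torsion:
  assumes "vector_field A X" "vector_field A Y"
  shows "D X Y p - D Y X p - lie_bracket X Y p =
    \<alpha> p *\<^sub>R (\<eta> p (Y p) *\<^sub>R X p - \<eta> p (X p) *\<^sub>R Y p) +
    \<beta> p *\<^sub>R (\<eta> p (Y p) *\<^sub>R \<phi> p (X p) - \<eta> p (X p) *\<^sub>R \<phi> p (Y p))"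
proof -
  have "torsion D X Y = \<alpha> \<odot> (app_form \<eta> Y \<odot> X - app_form \<eta> X \<odot> Y) +
      \<beta> \<odot> (app_form \<eta> Y \<odot> app_endo \<phi> X - app_form \<eta> X \<odot> app_endo \<phi> Y)"
    using gsm assms unfolding gen_symmetric_metric_connection_def by blast
  from fun_cong[OF this, of p] show ?thesis
    by (simp add: torsion_def fscale_def app_form_def app_endo_def)
qed

lemma N_torsion:
  assumes "vector_field A X" "vector_field A Y"
  shows "N X Y p - N Y X p - lie_bracket X Y p = 0"
proof -
  have "torsion N X Y = 0" using lc assms unfolding levi_civita_def by blast
  from fun_cong[OF this, of p] show ?thesis by (simp add: torsion_def)
qed

definition a :: "'a \<Rightarrow> real" where "a = (\<lambda>p. \<alpha> p + 1)"

lemma C_inf_a: "a \<in> C_inf A"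
  unfolding a_def by (rule C_inf_add[OF alpha C_inf_const])

text \<open>The horizontal projection, written as a sum with a negated coefficient so that the
  additivity and Leibniz rules of a connection apply directly.\<close>

definition P :: "'a vfield \<Rightarrow> 'a vfield"
  where "P X = X + (\<lambda>p. - \<eta> p (X p)) \<odot> \<xi>"

lemma P_apply: "P X p = X p - \<eta> p (X p) *\<^sub>R \<xi> p"
  by (simp add: P_def fscale_def)

lemma C_inf_neg_form:
  assumes "vector_field A X"
  shows "(\<lambda>p. - \<eta> p (X p)) \<in> C_inf A"
  using C_inf_diff[OF C_inf_const[of 0] C_inf_form[OF assms]] by (simp add: app_form_def)

lemma vector_field_P: "vector_field A X \<Longrightarrow> vector_field A (P X)"
  unfolding P_def by (intro vector_field_add vector_field_fscale C_inf_neg_form vf_xi)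

text \<open>Koszul's argument for the difference \<open>k\<close> of the two metric connections: it is skew in the last
  two slots, and its skew part in the first two slots is the torsion of \<open>D\<close>.\<close>

lemma D_xi:
  assumes X: "vector_field A X"
  shows "D X \<xi> = a \<odot> P X"
proof
  fix p
  define k where "k = (\<lambda>X Y Z. g p (D X Y p) (Z p) - g p (N X Y p) (Z p))"
  have tD: "D Y Z p \<in> tangent_space A p" and tN: "N Y Z p \<in> tangent_space A p"
    if "vector_field A Y" "vector_field A Z" for Y Z
    using linear_connectionD(1)[OF D_conn that] linear_connectionD(1)[OF N_conn that]
    by (auto dest: vector_fieldD(1))
  have skew: "k X Y Z = - k X Z Y"
    if v: "vector_field A X" "vector_field A Y" "vector_field A Z" for X Y Z
    using parallel_metricD[OF D_metric v, of p] parallel_metricD[OF N_metric v, of p]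
      tD[OF v(1,2)] tD[OF v(1,3)] tN[OF v(1,2)] tN[OF v(1,3)] vector_fieldD(1)[OF v(2), of p]
    by (simp add: k_def g_sym[of "Y p"])
  have tor: "k X Y Z - k Y X Z = \<alpha> p * (\<eta> p (Y p) * g p (X p) (Z p) - \<eta> p (X p) * g p (Y p) (Z p))
      + \<beta> p * (\<eta> p (Y p) * g p (\<phi> p (X p)) (Z p) - \<eta> p (X p) * g p (\<phi> p (Y p)) (Z p))"
    if v: "vector_field A X" "vector_field A Y" "vector_field A Z" for X Y Z
  proof -
    note t = tD[OF v(1,2)] tD[OF v(2,1)] tN[OF v(1,2)] tN[OF v(2,1)]
      vector_fieldD(1)[OF v(1), of p] vector_fieldD(1)[OF v(2), of p] vector_fieldD(1)[OF v(3), of p]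
    have e: "(D X Y p - D Y X p - lie_bracket X Y p) - (N X Y p - N Y X p - lie_bracket X Y p) =
        \<alpha> p *\<^sub>R (\<eta> p (Y p) *\<^sub>R X p - \<eta> p (X p) *\<^sub>R Y p) +
        \<beta> p *\<^sub>R (\<eta> p (Y p) *\<^sub>R \<phi> p (X p) - \<eta> p (X p) *\<^sub>R \<phi> p (Y p))"
      by (simp only: D_torsion[OF v(1,2)] N_torsion[OF v(1,2)] diff_zero)
    have "k X Y Z - k Y X Z = g p ((D X Y p - D Y X p - lie_bracket X Y p) -
        (N X Y p - N Y X p - lie_bracket X Y p)) (Z p)"
      using t vector_fieldD(1)[OF vector_field_lie_bracket[OF v(1,2)], of p] by (simp add: k_def)
    then show ?thesis using t unfolding e by simp
  qed
  have xp: "X p \<in> tangent_space A p" using vector_fieldD(1)[OF X] .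
  show "D X \<xi> p = (a \<odot> P X) p"
  proof (rule metric_eqI)
    show "D X \<xi> p \<in> tangent_space A p" using tD[OF X vf_xi] .
    show "(a \<odot> P X) p \<in> tangent_space A p"
      using vector_fieldD(1)[OF vector_field_fscale[OF C_inf_a vector_field_P[OF X]]] .
    fix w assume w: "w \<in> tangent_space A p"
    then obtain Z where Z: "vector_field A Z" "Z p = w" by (rule ex_vector_field)
    \<comment> \<open>With T for the right-hand side of \<open>tor\<close>, this is T(X,\<xi>,Z) +
      T(Z,\<xi>,X) - T(X,Z,\<xi>). The \<beta>-terms of the first two cancel because \<phi> is skew,
      and the third is 0.\<close>
    have "2 * k X \<xi> Z = 2 * \<alpha> p * (g p (X p) w - \<eta> p (X p) * \<eta> p w)"
      using skew[OF X vf_xi Z(1)] skew[OF Z(1) X vf_xi] skew[OF vf_xi Z(1) X]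
        tor[OF X Z(1) vf_xi] tor[OF Z(1) vf_xi X] tor[OF vf_xi X Z(1)]
        Z(2) w xp phi_skew[OF xp w] g_sym[OF w xp] g_sym[of "\<phi> p w" p "X p"]
      by (simp add: algebra_simps)
    \<comment> \<open>The Kenmotsu identity supplies the summand 1 in \<open>a\<close>.\<close>
    moreover have "g p (N X \<xi> p) w = g p (X p) w - \<eta> p (X p) * \<eta> p w"
      using xp w by (simp add: N_xi[OF X] fscale_def app_form_def)
    ultimately show "g p (D X \<xi> p) w = g p ((a \<odot> P X) p) w"
      using xp w Z(2) by (simp add: k_def fscale_def P_apply a_def algebra_simps)
  qed
qed

lemma tv_minus:
  assumes "v \<in> tangent_space A p" "f \<in> C_inf A"
  shows "v (\<lambda>x. - f x) = - v f"
  using tv_scale[OF assms, of "-1"] by simp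

text \<open>Differentiate \<open>a \<odot> P Y\<close> once more and skew-symmetrise: terms
  symmetric in \<open>X\<close> and \<open>Y\<close> cancel, and \<open>D X Y - D Y X\<close>
  combines with the bracket into the torsion \<open>t\<close>.\<close>

lemma curvature_xi:
  assumes X: "vector_field A X" and Y: "vector_field A Y"
  shows "curvature D X Y \<xi> p = X p a *\<^sub>R P Y p - Y p a *\<^sub>R P X p +
    a p *\<^sub>R (\<eta> p (X p) *\<^sub>R Y p - \<eta> p (Y p) *\<^sub>R X p +
      \<beta> p *\<^sub>R (\<eta> p (Y p) *\<^sub>R \<phi> p (X p) - \<eta> p (X p) *\<^sub>R \<phi> p (Y p)))"
proof -
  have DD: "D X (D Y \<xi>) p = X p a *\<^sub>R P Y p + a p *\<^sub>R (D X Y p -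
      (\<eta> p (D X Y p) + a p * (g p (X p) (Y p) - \<eta> p (X p) * \<eta> p (Y p))) *\<^sub>R \<xi> p -
      (\<eta> p (Y p) * a p) *\<^sub>R P X p)" if X: "vector_field A X" and Y: "vector_field A Y" for X Y
  proof -
    have tX: "X p \<in> tangent_space A p" and tY: "Y p \<in> tangent_space A p"
      and tD: "D X Y p \<in> tangent_space A p"
      using X Y linear_connectionD(1)[OF D_conn X Y] by (auto dest: vector_fieldD(1))
    \<comment> \<open>As \<eta> is the metric paired with \<xi>, metric compatibility differentiates
      it too.\<close>
    have e: "app_form \<eta> Y = app_metric g Y \<xi>"
      using vector_fieldD(1)[OF Y] by (auto simp: app_form_def app_metric_def)
    have "X p (app_form \<eta> Y) = \<eta> p (D X Y p) + a p * (g p (X p) (Y p) - \<eta> p (X p) * \<eta> p (Y p))"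
      unfolding e parallel_metricD[OF D_metric X Y vf_xi] D_xi[OF X]
      using tX tY tD by (simp add: fscale_def P_apply g_sym[of "X p"] algebra_simps)
    then have n: "X p (\<lambda>p. - \<eta> p (Y p)) =
        - (\<eta> p (D X Y p) + a p * (g p (X p) (Y p) - \<eta> p (X p) * \<eta> p (Y p)))"
      using tv_minus[OF tX C_inf_form[OF Y]] by (simp add: app_form_def)
    have "D X (P Y) = D X Y + ((\<lambda>p. X p (\<lambda>p. - \<eta> p (Y p))) \<odot> \<xi> + (\<lambda>p. - \<eta> p (Y p)) \<odot> D X \<xi>)"
      unfolding P_def
      by (simp only: linear_connectionD(2)[OF D_conn Y vector_field_fscale[OF C_inf_neg_form[OF Y] vf_xi] X]
          linear_connectionD(3)[OF D_conn C_inf_neg_form[OF Y] X vf_xi])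
    then have DP: "D X (P Y) p = D X Y p -
        (\<eta> p (D X Y p) + a p * (g p (X p) (Y p) - \<eta> p (X p) * \<eta> p (Y p))) *\<^sub>R \<xi> p -
        (\<eta> p (Y p) * a p) *\<^sub>R P X p"
      by (simp add: fscale_def n D_xi[OF X] scaleR_left_distrib scaleR_left_diff_distrib)
    have "D X (D Y \<xi>) = (\<lambda>p. X p a) \<odot> P Y + a \<odot> D X (P Y)"
      unfolding D_xi[OF Y] by (rule linear_connectionD(3)[OF D_conn C_inf_a X vector_field_P[OF Y]])
    then show ?thesis by (simp add: fscale_def DP)
  qed
  have tX: "X p \<in> tangent_space A p" and tY: "Y p \<in> tangent_space A p"
    and tXY: "D X Y p \<in> tangent_space A p" and tYX: "D Y X p \<in> tangent_space A p"
    and tB: "lie_bracket X Y p \<in> tangent_space A p"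
    using X Y linear_connectionD(1)[OF D_conn X Y] linear_connectionD(1)[OF D_conn Y X]
      vector_field_lie_bracket[OF X Y] by (auto dest: vector_fieldD(1))
  define t where "t = D X Y p - D Y X p - lie_bracket X Y p"
  have t: "t = \<alpha> p *\<^sub>R (\<eta> p (Y p) *\<^sub>R X p - \<eta> p (X p) *\<^sub>R Y p) +
    \<beta> p *\<^sub>R (\<eta> p (Y p) *\<^sub>R \<phi> p (X p) - \<eta> p (X p) *\<^sub>R \<phi> p (Y p))"
    unfolding t_def by (rule D_torsion[OF X Y])
  have tt: "t \<in> tangent_space A p" using tXY tYX tB by (simp add: t_def)
  \<comment> \<open>Together with the symmetry of the other terms in the derivative of \<eta>(Y),
    this amounts to d \<eta> = 0.\<close>
  have "\<eta> p t = 0" using tX tY by (simp add: t)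
  have dxy: "D X Y p = D Y X p + lie_bracket X Y p + t" by (simp add: t_def)
  have "curvature D X Y \<xi> p = X p a *\<^sub>R P Y p - Y p a *\<^sub>R P X p +
      a p *\<^sub>R (t + (\<eta> p (X p) * a p) *\<^sub>R P Y p - (\<eta> p (Y p) * a p) *\<^sub>R P X p)"
    unfolding curvature_def
    using tX tY tB tt tYX \<open>\<eta> p t = 0\<close>
    by (simp add: DD[OF X Y] DD[OF Y X] D_xi[OF vector_field_lie_bracket[OF X Y]] fscale_def
        P_apply[of "lie_bracket X Y"] dxy g_sym[of "Y p" p "X p"] algebra_simps)
  \<comment> \<open>The \<alpha>-part of \<open>t\<close> is -\<alpha> times \<eta>(X) PY -
    \<eta>(Y) PX. The same expression occurs with the factor \<open>a\<close>, so the coefficient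
    \<open>a\<close> - \<alpha> = 1 is left.\<close>
  also have "t + (\<eta> p (X p) * a p) *\<^sub>R P Y p - (\<eta> p (Y p) * a p) *\<^sub>R P X p =
      \<eta> p (X p) *\<^sub>R Y p - \<eta> p (Y p) *\<^sub>R X p +
      \<beta> p *\<^sub>R (\<eta> p (Y p) *\<^sub>R \<phi> p (X p) - \<eta> p (X p) *\<^sub>R \<phi> p (Y p))"
    by (simp add: t P_apply a_def algebra_simps)
  finally show ?thesis .
qed

lemma ricci_xi:
  assumes Y: "vector_field A Y"
  shows "ricci A D Y \<xi> p = P Y p a - (real DIM('e) - 1) * (Y p a + a p * \<eta> p (Y p))"
proof -
  obtain T :: "'e \<Rightarrow> 'a tvec" where T: "linear T" "inj T" "range T = tangent_space A p"
    by (rule tangent_space_iso)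
  interpret coordinatized_subspace "tangent_space A p" T by (rule coordinatized_subspace.intro[OF T])
  let ?tr = "trace_on (tangent_space A p)"
  have tY: "Y p \<in> tangent_space A p" and tPY: "P Y p \<in> tangent_space A p"
    using vector_fieldD(1)[OF Y] vector_fieldD(1)[OF vector_field_P[OF Y]] by blast+
  have lin_a: "linear_on_subspace (tangent_space A p) (\<lambda>v. v a)"
    by (simp add: linear_on_subspace_def)
  have lin_k: "linear_on_subspace (tangent_space A p) (\<lambda>v. k * \<eta> p v)" for k
    by (simp add: linear_on_subspace_def algebra_simps)
  \<comment> \<open>\<open>curvature_xi\<close> as a function of the value \<open>v\<close> of the
    first field, split into rank one maps, a multiple of the identity and a multiple of \<phi>,
    whose traces are known one by one.\<close>
  let ?F = "\<lambda>v. v a *\<^sub>R P Y p + ((- Y p a - a p * \<eta> p (Y p)) *\<^sub>R v + ((Y p a * \<eta> p v) *\<^sub>R \<xi> p +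
      ((a p * \<eta> p v) *\<^sub>R Y p + ((a p * \<beta> p * \<eta> p (Y p)) *\<^sub>R \<phi> p v +
      (- (a p * \<beta> p) * \<eta> p v) *\<^sub>R \<phi> p (Y p)))))"
  have "induced_endo A (\<lambda>X. curvature D X Y \<xi>) p v = ?F v" if v: "v \<in> tangent_space A p" for v
  proof -
    \<comment> \<open>By \<open>curvature_xi\<close> the result depends on the field only through
      its value at \<open>p\<close>, so the extension chosen in \<open>induced_endo\<close> is
      immaterial.\<close>
    let ?X = "SOME X. vector_field A X \<and> X p = v"
    have "\<exists>X. vector_field A X \<and> X p = v" using ex_vector_field[OF v] by metis
    then have X: "vector_field A ?X \<and> ?X p = v" by (rule someI_ex)
    show ?thesis unfolding induced_endo_def
      using curvature_xi[OF conjunct1[OF X] Y, of p] X by (simp add: P_apply algebra_simps)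
  qed
  then have "ricci A D Y \<xi> p = ?tr ?F" unfolding ricci_def by (rule trace_on_cong)
  also have "\<dots> = P Y p a + ((- Y p a - a p * \<eta> p (Y p)) * real DIM('e) + (Y p a * \<eta> p (\<xi> p) +
      (a p * \<eta> p (Y p) + (a p * \<beta> p * \<eta> p (Y p) * 0 + - (a p * \<beta> p) * \<eta> p (\<phi> p (Y p))))))"
  proof -
    have tr_phi: "?tr (\<phi> p) = 0"
      by (rule trace_on_skew[where g="g p"])
        (auto intro: g_linear g_sym g_pos phi_linear phi_skew)
    have im: "(\<lambda>v. f v *\<^sub>R y) ` tangent_space A p \<subseteq> tangent_space A p" if "y \<in> tangent_space A p"
      for f y using that by auto
    have im2: "(\<lambda>v. k *\<^sub>R L v) ` tangent_space A p \<subseteq> tangent_space A p"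
      if "L ` tangent_space A p \<subseteq> tangent_space A p" for L k using that by auto
    have imp: "(\<lambda>v. L v + M v) ` tangent_space A p \<subseteq> tangent_space A p"
      if "L ` tangent_space A p \<subseteq> tangent_space A p" "M ` tangent_space A p \<subseteq> tangent_space A p"
      for L M using that by auto
    have imv: "(\<lambda>v. v) ` tangent_space A p \<subseteq> tangent_space A p" by simp
    note ims = im[OF tPY] im[OF tY] im[OF tangent_closed(2)] im[OF tangent_closed(7)[OF tY]]
      im2[OF imv] im2[OF phi_image]
    show ?thesis
      by (subst trace_on_add; (intro imp ims)?)+
        (simp only: trace_on_rank1[OF lin_a tPY] trace_on_scale[OF imv] trace_on_id
          trace_on_rank1[OF lin_k tangent_closed(2)] trace_on_rank1[OF lin_k tY]
          trace_on_rank1[OF lin_k tangent_closed(7)[OF tY]] trace_on_scale[OF phi_image] tr_phi)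
  qed
  also have "\<dots> = P Y p a - (real DIM('e) - 1) * (Y p a + a p * \<eta> p (Y p))"
    using tY by (simp add: algebra_simps)
  finally show ?thesis .
qed

lemma vector_field_curvature:
  "vector_field A X \<Longrightarrow> vector_field A Y \<Longrightarrow> vector_field A Z \<Longrightarrow> vector_field A (curvature D X Y Z)"
  unfolding curvature_def
  by (intro vector_field_diff linear_connectionD(1)[OF D_conn] vector_field_lie_bracket)

text \<open>Expand the bracket of \<open>X\<close> and \<open>Y\<close> applied to g(Z,W) by metric
  compatibility; the mixed terms are symmetric in \<open>X\<close> and \<open>Y\<close> and cancel.
  Torsion does not interfere, as only the Lie bracket occurs.\<close>

lemma curvature_skew:
  assumes X: "vector_field A X" and Y: "vector_field A Y"
    and Z: "vector_field A Z" and W: "vector_field A W"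
  shows "g p (curvature D X Y Z p) (W p) = - g p (Z p) (curvature D X Y W p)"
proof -
  note vD = linear_connectionD(1)[OF D_conn]
  have dd: "X p (\<lambda>q. Y q (app_metric g Z W)) = g p (D X (D Y Z) p) (W p) + g p (D Y Z p) (D X W p) +
      (g p (D X Z p) (D Y W p) + g p (Z p) (D X (D Y W) p))"
    if X: "vector_field A X" and Y: "vector_field A Y" for X Y
  proof -
    have "(\<lambda>q. Y q (app_metric g Z W)) = (\<lambda>q. app_metric g (D Y Z) W q + app_metric g Z (D Y W) q)"
      by (simp add: parallel_metricD[OF D_metric Y Z W] app_metric_apply)
    then have "X p (\<lambda>q. Y q (app_metric g Z W)) =
        X p (app_metric g (D Y Z) W) + X p (app_metric g Z (D Y W))"
      by (simp add: tv_add[OF vector_fieldD(1)[OF X] C_inf_metric C_inf_metric] vD X Y Z W)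
    then show ?thesis
      by (simp add: parallel_metricD[OF D_metric X] vD X Y Z W)
  qed
  have t: "U p \<in> tangent_space A p" if "vector_field A U" for U using vector_fieldD(1)[OF that] .
  have "lie_bracket X Y p (app_metric g Z W) =
      X p (\<lambda>q. Y q (app_metric g Z W)) - Y p (\<lambda>q. X q (app_metric g Z W))"
    by (simp add: lie_bracket_def)
  with dd[OF X Y] dd[OF Y X] parallel_metricD[OF D_metric vector_field_lie_bracket[OF X Y] Z W, of p]
  show ?thesis
    by (simp add: curvature_def t vD X Y Z W vector_field_lie_bracket[OF X Y])
qed

end

section \<open>The soliton equation\<close>

locale kenmotsu_gsm_soliton = kenmotsu_gsm A \<phi> \<xi> \<eta> g N D \<alpha> \<beta>
  for A :: "('a::{t2_space, second_countable_topology}, 'e::euclidean_space) atlas"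
    and \<phi> \<xi> \<eta> g N D \<alpha> \<beta> +
  fixes l m :: real and n :: nat
  assumes n: "n \<ge> 1" and dim: "DIM('e) = 2 * n + 1"
    and soliton: "eta_ricci_soliton A D \<xi> \<eta> g l m"
begin

section \<open>Ricci tensor, Ricci operator and W2 tensor of a soliton\<close>

lemma tangent_D_xi: "vector_field A X \<Longrightarrow> D X \<xi> p = a p *\<^sub>R (X p - \<eta> p (X p) *\<^sub>R \<xi> p)"
  by (simp add: D_xi fscale_def P_apply)

lemma ricci_eq:
  assumes X: "vector_field A X" and Y: "vector_field A Y"
  shows "ricci A D X Y p = - (l + a p) * g p (X p) (Y p) + (a p - m) * (\<eta> p (X p) * \<eta> p (Y p))"
proof -
  have "app_metric g (D X \<xi>) Y p + app_metric g X (D Y \<xi>) p + 2 * ricci A D X Y p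
      + 2 * l * app_metric g X Y p + 2 * m * app_form \<eta> X p * app_form \<eta> Y p = 0"
    using soliton X Y unfolding eta_ricci_soliton_def by blast
  then show ?thesis
    using vector_fieldD(1)[OF X, of p] vector_fieldD(1)[OF Y, of p]
    by (simp add: app_metric_apply app_form_def tangent_D_xi X Y algebra_simps)
qed

text \<open>Two expressions for S(Y,\<xi>) are compared. On \<open>P Y\<close> every \<eta>-term
  vanishes and \<open>P\<close> is idempotent, leaving the nonzero factor 1 - 2n; on \<xi> the
  equation then yields the derivative of \<open>a\<close>.\<close>

lemma
  shows P_a_eq_0: "vector_field A Y \<Longrightarrow> P Y p a = 0"
    and xi_a: "\<xi> p a = (l + m) / (2 * n) - a p"
proof -
  have main: "P Y p a - 2 * n * (Y p a + a p * \<eta> p (Y p)) = - (l + m) * \<eta> p (Y p)"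
    if Y: "vector_field A Y" for Y
    using ricci_xi[OF Y, of p] ricci_eq[OF Y vf_xi, of p] vector_fieldD(1)[OF Y, of p] dim
    by (simp add: algebra_simps)
  show P0: "P Y p a = 0" if Y: "vector_field A Y" for Y
  proof -
    have "\<eta> p (P Y p) = 0" using vector_fieldD(1)[OF Y, of p] by (simp add: P_apply)
    then have "P (P Y) p = P Y p" by (simp add: P_apply[of "P Y"])
    with main[OF vector_field_P[OF Y]] \<open>\<eta> p (P Y p) = 0\<close> have "(1 - 2 * real n) * P Y p a = 0"
      by (simp add: algebra_simps)
    then show ?thesis using n by simp
  qed
  show "\<xi> p a = (l + m) / (2 * n) - a p"
    using main[OF vf_xi] P0[OF vf_xi] n by (simp add: field_simps)
qed

lemma ricci_operator_eq:
  assumes X: "vector_field A X"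
  shows "vector_field A (ricci_operator A g D X)"
    and "ricci_operator A g D X p = - (l + a p) *\<^sub>R X p + ((a p - m) * \<eta> p (X p)) *\<^sub>R \<xi> p"
proof -
  \<comment> \<open>The tensor of \<open>ricci_eq\<close> with one index raised; the coefficients
    are products and sums to which the closure rules of \<open>C_inf\<close> apply.\<close>
  let ?Q = "(\<lambda>p. - 1 * (l + a p)) \<odot> X + (\<lambda>p. (a p - m) * app_form \<eta> X p) \<odot> \<xi>"
  have Q: "vector_field A ?Q"
    by (intro vector_field_add vector_field_fscale C_inf_mult C_inf_add C_inf_diff C_inf_const C_inf_a
        C_inf_form X vf_xi)
  have gQ: "app_metric g ?Q Y = ricci A D X Y" if Y: "vector_field A Y" for Y
    using vector_fieldD(1)[OF X] vector_fieldD(1)[OF Y]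
    by (intro ext) (simp add: app_metric_apply ricci_eq[OF X Y] fscale_def app_form_def algebra_simps)
  have "ricci_operator A g D X = ?Q"
    unfolding ricci_operator_def
  proof (rule the_equality)
    show "vector_field A ?Q \<and> (\<forall>Y. vector_field A Y \<longrightarrow> app_metric g ?Q Y = ricci A D X Y)"
      using Q gQ by blast
    fix W assume W: "vector_field A W \<and> (\<forall>Y. vector_field A Y \<longrightarrow> app_metric g W Y = ricci A D X Y)"
    show "W = ?Q"
    proof
      fix p
      show "W p = ?Q p"
      proof (rule metric_eqI)
        show "W p \<in> tangent_space A p" "?Q p \<in> tangent_space A p"
          using W Q vector_fieldD(1) by blast+
        fix w assume "w \<in> tangent_space A p"
        then obtain Y where Y: "vector_field A Y" "Y p = w" by (rule ex_vector_field)
        then have "app_metric g W Y = app_metric g ?Q Y" using W gQ by simp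
        from fun_cong[OF this, of p] show "g p (W p) w = g p (?Q p) w"
          using Y(2) by (simp add: app_metric_apply)
      qed
    qed
  qed
  then show "vector_field A (ricci_operator A g D X)"
    and "ricci_operator A g D X p = - (l + a p) *\<^sub>R X p + ((a p - m) * \<eta> p (X p)) *\<^sub>R \<xi> p"
    using Q by (simp_all add: fscale_def app_form_def)
qed

lemma W2_apply:
  assumes "vector_field A X" "vector_field A Y" "vector_field A Z"
  shows "W2_curvature A g D X Y Z p = curvature D X Y Z p + (1 / (2 * real n)) *\<^sub>R
    (g p (X p) (Z p) *\<^sub>R (- (l + a p) *\<^sub>R Y p + ((a p - m) * \<eta> p (Y p)) *\<^sub>R \<xi> p) -
     g p (Y p) (Z p) *\<^sub>R (- (l + a p) *\<^sub>R X p + ((a p - m) * \<eta> p (X p)) *\<^sub>R \<xi> p))"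
  unfolding W2_curvature_def
  by (simp add: fscale_def app_metric_apply ricci_operator_eq(2) assms dim)

lemma vector_field_W2:
  assumes "vector_field A X" "vector_field A Y" "vector_field A Z"
  shows "vector_field A (W2_curvature A g D X Y Z)"
proof -
  have "vector_field A (curvature D X Y Z + (\<lambda>p. 1 / (real DIM('e) - 1)) \<odot>
      (app_metric g X Z \<odot> ricci_operator A g D Y - app_metric g Y Z \<odot> ricci_operator A g D X))"
    by (intro vector_field_add vector_field_curvature vector_field_fscale vector_field_diff
        C_inf_const C_inf_metric ricci_operator_eq(1) assms)
  moreover have "(\<lambda>p. k) \<odot> X = k *\<^sub>R X" for k and X :: "'a vfield"
    by (simp add: fscale_def scaleR_fun_def)
  ultimately show ?thesis unfolding W2_curvature_def by simp
qed

text \<open>The \<open>\<xi>\<close>-component of the condition \<open>S \<cdot> W\<^sub>2 = 0\<close> at \<open>Z = V = \<xi>\<close>.\<close>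

lemma S_dot_W2_horizontal:
  assumes SW: "S_dot_W2_zero A g D \<xi>"
    and x: "x \<in> tangent_space A p" "\<eta> p x = 0" and y: "y \<in> tangent_space A p" "\<eta> p y = 0"
  shows "(l + a p) * (a p - m) / (2 * n) * g p x y +
    a p * \<beta> p * (2 * l + a p + m) * g p x (\<phi> p y) = 0"
proof -
  obtain X where X: "vector_field A X" "X p = x" by (rule ex_vector_field[OF x(1)])
  obtain Y where Y: "vector_field A Y" "Y p = y" by (rule ex_vector_field[OF y(1)])
  let ?W = "W2_curvature A g D" and ?S = "ricci A D"
  note vW = vector_field_W2
  have eq: "?S X (?W Y \<xi> \<xi>) p *\<^sub>R \<xi> p - ?S \<xi> (?W Y \<xi> \<xi>) p *\<^sub>R X p
      + ?S X Y p *\<^sub>R ?W \<xi> \<xi> \<xi> p - ?S \<xi> Y p *\<^sub>R ?W X \<xi> \<xi> p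
      + ?S X \<xi> p *\<^sub>R ?W Y \<xi> \<xi> p - ?S \<xi> \<xi> p *\<^sub>R ?W Y X \<xi> p
      + ?S X \<xi> p *\<^sub>R ?W Y \<xi> \<xi> p - ?S \<xi> \<xi> p *\<^sub>R ?W Y \<xi> X p = 0"
  proof -
    have "?S X (?W Y \<xi> \<xi>) \<odot> \<xi> - ?S \<xi> (?W Y \<xi> \<xi>) \<odot> X
      + ?S X Y \<odot> ?W \<xi> \<xi> \<xi> - ?S \<xi> Y \<odot> ?W X \<xi> \<xi>
      + ?S X \<xi> \<odot> ?W Y \<xi> \<xi> - ?S \<xi> \<xi> \<odot> ?W Y X \<xi>
      + ?S X \<xi> \<odot> ?W Y \<xi> \<xi> - ?S \<xi> \<xi> \<odot> ?W Y \<xi> X = 0"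
      using SW X(1) Y(1) vf_xi unfolding S_dot_W2_zero_def Let_def by blast
    from fun_cong[OF this, of p] show ?thesis by (simp add: fscale_def)
  qed
  have P_hor: "P U p = U p" if "\<eta> p (U p) = 0" for U using that by (simp add: P_apply)
  have Pxi: "P \<xi> p = 0" by (simp add: P_apply)
  have ya: "y a = 0" and xa: "x a = 0"
    using P_a_eq_0[OF X(1), of p] P_a_eq_0[OF Y(1), of p] P_hor[of X] P_hor[of Y] X(2) Y(2) x y by auto
  have R: "curvature D Y \<xi> \<xi> p = - ((l + m) / (2 * n)) *\<^sub>R y + (a p * \<beta> p) *\<^sub>R \<phi> p y"
    using curvature_xi[OF Y(1) vf_xi, of p] Y(2) y ya xi_a[of p] P_hor[of Y]
    by (simp add: Pxi algebra_simps)
  \<comment> \<open>Only g(\<xi>,\<xi>) QY survives in the Ricci part of W2 and contributes (l + a)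
    y / 2n; with -(l + m) y / 2n from \<open>R\<close> the coefficient becomes (a - m) / 2n.\<close>
  have w1: "?W Y \<xi> \<xi> p = ((a p - m) / (2 * n)) *\<^sub>R y + (a p * \<beta> p) *\<^sub>R \<phi> p y"
    using R y Y(2) by (simp add: W2_apply[OF Y(1) vf_xi vf_xi] diff_divide_distrib add_divide_distrib algebra_simps)
  have w0: "\<eta> p (?W \<xi> \<xi> \<xi> p) = 0"
    using curvature_xi[OF vf_xi vf_xi, of p] by (simp add: W2_apply[OF vf_xi vf_xi vf_xi] Pxi)
  have w2: "\<eta> p (?W Y X \<xi> p) = 0"
    using curvature_xi[OF Y(1) X(1), of p] x y X(2) Y(2) xa ya
    by (simp add: W2_apply[OF Y(1) X(1) vf_xi])
  have RX: "curvature D Y \<xi> X p \<in> tangent_space A p"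
    using vector_fieldD(1)[OF vector_field_curvature[OF Y(1) vf_xi X(1)]] .
  have "\<eta> p (curvature D Y \<xi> X p) = - g p x (curvature D Y \<xi> \<xi> p)"
    using curvature_skew[OF Y(1) vf_xi X(1) vf_xi, of p] RX X(2) by simp
  \<comment> \<open>The multiple of g(x,y) in -g(x, R(Y,\<xi>)\<xi>) is (l + m) / 2n. The Ricci part
    of W2 contributes \<eta>(Q \<xi>) / 2n = -(l + m) / 2n and cancels it.\<close>
  then have w3: "\<eta> p (?W Y \<xi> X p) = - (a p * \<beta> p) * g p x (\<phi> p y)"
    using RX R x y X(2) Y(2) g_sym[OF x(1) y(1)]
    by (simp add: W2_apply[OF Y(1) vf_xi X(1)] diff_divide_distrib add_divide_distrib algebra_simps)
  have S1: "?S X (?W Y \<xi> \<xi>) p = - (l + a p) * g p x (((a p - m) / (2 * n)) *\<^sub>R y + (a p * \<beta> p) *\<^sub>R \<phi> p y)"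
    using ricci_eq[OF X(1) vW[OF Y(1) vf_xi vf_xi], of p] w1 X(2) x by simp
  have S2: "?S \<xi> Y p = 0" "?S X \<xi> p = 0" "?S \<xi> \<xi> p = - (l + m)"
    using ricci_eq[OF vf_xi Y(1), of p] ricci_eq[OF X(1) vf_xi, of p] ricci_eq[OF vf_xi vf_xi, of p]
      x y X(2) Y(2) by simp_all
  have t: "?W U V Z p \<in> tangent_space A p" if "vector_field A U" "vector_field A V" "vector_field A Z" for U V Z
    using vector_fieldD(1)[OF vW[OF that]] .
  have "0 = \<eta> p (?S X (?W Y \<xi> \<xi>) p *\<^sub>R \<xi> p - ?S \<xi> (?W Y \<xi> \<xi>) p *\<^sub>R X p
      + ?S X Y p *\<^sub>R ?W \<xi> \<xi> \<xi> p - ?S \<xi> Y p *\<^sub>R ?W X \<xi> \<xi> p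
      + ?S X \<xi> p *\<^sub>R ?W Y \<xi> \<xi> p - ?S \<xi> \<xi> p *\<^sub>R ?W Y X \<xi> p
      + ?S X \<xi> p *\<^sub>R ?W Y \<xi> \<xi> p - ?S \<xi> \<xi> p *\<^sub>R ?W Y \<xi> X p)"
    unfolding eq by simp
  \<comment> \<open>By \<open>S2\<close>, \<open>w0\<close>, \<open>w2\<close> and \<eta>(x) = 0 two
    of the eight terms survive. Up to a common sign their \<phi>-parts carry l + a and l + m, which
    add up to 2l + a + m.\<close>
  also have "\<dots> = ?S X (?W Y \<xi> \<xi>) p + (l + m) * \<eta> p (?W Y \<xi> X p)"
    using x X(2) by (simp add: S2 t X(1) Y(1) vf_xi w0 w2 algebra_simps)
  finally show ?thesis
    using x y unfolding S1 w3 by (simp add: add_divide_distrib diff_divide_distrib algebra_simps)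
qed

text \<open>\<eta> composed with \<open>T\<close> is a linear functional on a space of dimension 2n
  + 1 > 1, so its kernel is nonzero.\<close>

lemma ex_horizontal: obtains y where "y \<in> tangent_space A p" "\<eta> p y = 0" "y \<noteq> 0"
proof -
  obtain T :: "'e \<Rightarrow> 'a tvec" where T: "linear T" "inj T" "range T = tangent_space A p"
    by (rule tangent_space_iso)
  have TT: "T x \<in> tangent_space A p" for x using T(3) by blast
  have "linear (\<lambda>x. \<eta> p (T x))"
    by (rule linearI) (simp_all add: linear_add[OF T(1)] linear_cmul[OF T(1)] TT)
  moreover have "\<not> inj (\<lambda>x. \<eta> p (T x))"
  proof
    assume "inj (\<lambda>x. \<eta> p (T x))"
    then have "DIM('e) \<le> DIM(real)"
      using dim_image_eq[OF calculation, of UNIV] dim_subset_UNIV[of "range (\<lambda>x. \<eta> p (T x))"]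
      by (simp add: inj_on_def)
    then show False using dim n by simp
  qed
  ultimately obtain x where "x \<noteq> 0" "\<eta> p (T x) = 0" using linear_injective_0 by blast
  moreover have "T x \<noteq> 0" using \<open>x \<noteq> 0\<close> linear_injective_0[OF T(1)] T(2) by blast
  ultimately show ?thesis using that TT by blast
qed

lemma soliton_relations:
  assumes SW: "S_dot_W2_zero A g D \<xi>"
  shows "(l + a p) * (a p - m) = 0" "a p = (l + m) / (2 * n)" "\<beta> p * a p * (2 * l + a p + m) = 0"
proof -
  \<comment> \<open>Both relations are established at every point, because the first is
    differentiated below.\<close>
  have rel: "(l + a p) * (a p - m) = 0 \<and> \<beta> p * a p * (2 * l + a p + m) = 0" for p
  proof -
    obtain y where y: "y \<in> tangent_space A p" "\<eta> p y = 0" "y \<noteq> 0" by (rule ex_horizontal)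
    have pos: "g p y y > 0" using g_pos y by blast
    have "g p y (\<phi> p y) = 0" using phi_skew[OF y(1) y(1)] g_sym[OF y(1), of "\<phi> p y"] y by simp
    then have "(l + a p) * (a p - m) / (2 * n) * g p y y = 0"
      using S_dot_W2_horizontal[OF SW y(1,2) y(1,2)] by simp
    then have 1: "(l + a p) * (a p - m) = 0" using pos n by auto
    have "a p * \<beta> p * (2 * l + a p + m) * g p (\<phi> p y) (\<phi> p y) = 0"
      using S_dot_W2_horizontal[OF SW _ _ y(1,2), of "\<phi> p y"] y 1 by simp
    moreover have "g p (\<phi> p y) (\<phi> p y) = g p y y" using g_phi_phi[OF y(1) y(1)] y by simp
    ultimately show ?thesis using 1 pos by auto
  qed
  then show "(l + a p) * (a p - m) = 0" "\<beta> p * a p * (2 * l + a p + m) = 0" by blast+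
  have tp: "\<xi> p \<in> tangent_space A p" by simp
  have "(\<lambda>q. (l + a q) * (a q - m)) = (\<lambda>q. 0)" using rel by blast
  then have "\<xi> p (\<lambda>q. (l + a q) * (a q - m)) = 0" using tv_const[OF tp, of 0] by metis
  moreover have "\<xi> p (\<lambda>q. (l + a q) * (a q - m)) = (l + a p) * \<xi> p a + (a p - m) * \<xi> p a"
    using C_inf_a C_inf_add[OF C_inf_const C_inf_a] C_inf_diff[OF C_inf_a C_inf_const]
    by (simp add: tv_mult[OF tp] tv_add[OF tp] tv_diff[OF tp] tv_const[OF tp] C_inf_const)
  ultimately have d: "(2 * a p + l - m) * \<xi> p a = 0" by (simp add: algebra_simps)
  \<comment> \<open>The factor in \<open>d\<close> is the sum of \<open>l + a p\<close> and
    \<open>a p - m\<close>, whose difference is \<open>l + m\<close>. If \<open>l + m\<close> is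
    nonzero, exactly one of the two vanishes and the sum is nonzero. If \<open>l + m = 0\<close>,
    they coincide, so both vanish everywhere and \<open>a\<close> is constant.\<close>
  have "\<xi> p a = 0"
  proof (cases "l + m = 0")
    case False
    then have "2 * a p + l - m \<noteq> 0" using rel[of p] by auto
    then show ?thesis using d by simp
  next
    case True
    then have "l + a q = 0" for q using rel[of q] by (auto simp: add_eq_0_iff)
    then have "a = (\<lambda>q. - l)" by (auto simp: fun_eq_iff add_eq_0_iff)
    then show ?thesis using tv_const[OF tp] by simp
  qed
  then show "a p = (l + m) / (2 * n)" using xi_a[of p] by simp
qed

end

theorem theorem10p1:
  fixes A :: "('a::{t2_space, second_countable_topology}, 'e::euclidean_space) atlas"
    and \<phi> :: "'a \<Rightarrow> 'a tvec \<Rightarrow> 'a tvec"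
    and \<xi> :: "'a vfield"
    and \<eta> :: "'a \<Rightarrow> 'a tvec \<Rightarrow> real"
    and g :: "'a \<Rightarrow> 'a tvec \<Rightarrow> 'a tvec \<Rightarrow> real"
    and nabla nabla_bar :: "'a conn"
    and \<alpha> \<beta> :: "'a \<Rightarrow> real"
    and l m :: real
    and n :: nat
  assumes "n \<ge> 1" and "DIM('e) = 2 * n + 1"
    and "kenmotsu A \<phi> \<xi> \<eta> g nabla"
    and "\<alpha> \<in> C_inf A" and "\<beta> \<in> C_inf A"
    and "gen_symmetric_metric_connection A \<phi> \<eta> g \<alpha> \<beta> nabla_bar"
    and "eta_ricci_soliton A nabla_bar \<xi> \<eta> g l m"
    and "S_dot_W2_zero A g nabla_bar \<xi>"
  shows "\<forall>p. - (\<alpha> p + 1) * (2 * l + \<alpha> p + 1 + m)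
               + ((l + \<alpha> p + 1)\<^sup>2 + (l + m)\<^sup>2) / (2 * real n) = 0 \<and>
             \<beta> p * (\<alpha> p + 1) * (2 * l + \<alpha> p + 1 + m) = 0"
proof
  fix p
  interpret kenmotsu_gsm_soliton A \<phi> \<xi> \<eta> g nabla nabla_bar \<alpha> \<beta> l m n
    by unfold_locales (fact assms)+
  note rel = soliton_relations[OF assms(8), of p]
  have e: "2 * l + \<alpha> p + 1 + m = 2 * l + a p + m" "l + \<alpha> p + 1 = l + a p" "\<alpha> p + 1 = a p"
    by (simp_all add: a_def)
  have t: "l + m = 2 * real n * a p" using rel(2) assms(1) by (simp add: field_simps)
  \<comment> \<open>As (l + a)(a - m) = 0, the square of l + a equals (l + a)(l + m), which makes l
    + m a common factor; \<open>t\<close> then cancels the denominator 2n.\<close>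
  have "(l + a p)\<^sup>2 + (l + m)\<^sup>2 = (l + m) * (2 * l + a p + m)"
    using rel(1) by (simp add: power2_eq_square algebra_simps)
  also have "\<dots> = 2 * real n * (a p * (2 * l + a p + m))" by (simp add: t)
  finally have "((l + a p)\<^sup>2 + (l + m)\<^sup>2) / (2 * real n) = a p * (2 * l + a p + m)"
    using assms(1) by simp
  then show "- (\<alpha> p + 1) * (2 * l + \<alpha> p + 1 + m) +
      ((l + \<alpha> p + 1)\<^sup>2 + (l + m)\<^sup>2) / (2 * real n) = 0 \<and>
      \<beta> p * (\<alpha> p + 1) * (2 * l + \<alpha> p + 1 + m) = 0"
    using rel(3) unfolding e by simp
qed

end
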